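(* Let $\mathrm{M}=\langle e_1+I,\ e_2+I,\ -I\rangle$ and $\Delta=\langle e_1+I,\ e_1/2+\sqrt3 e_2/2+I,\ -I\rangle$, where $e_1,e_2$ are the standard basis vectors of $E^2$. Let $\mathrm{K}=\langle (e_1/2+I)_\star,(e_2/2+I)_\star\rangle\subseteq\mathrm{Aff}(\mathrm{M})$ and let $$A=\begin{pmatrix}-1&0\\0&1\end{pmatrix},\ B=\begin{pmatrix}-1&1\\0&1\end{pmatrix},\ C=\begin{pmatrix}0&1\\1&0\end{pmatrix},\ D=\begin{pmatrix}1&-1/2\\0&\sqrt3/2\end{pmatrix}.$$ Then $\mathrm{Sym}(\mathrm{M})=\langle \mathrm{K}, A_\star, C_\star\rangle$, $D\mathrm{M}D^{-1}=\Delta$, the map $D_\sharp:\mathrm{Aff}(\mathrm{M})\to\mathrm{Aff}(\Delta)$ is an isomorphism, and $\mathrm{Sym}(\Delta)=D_\sharp(\langle \mathrm{K}, B_\star, C_\star\rangle)$.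
   Context: Affine maps of $E^2$ are written $a+A$ (meaning $x\mapsto a+Ax$); $a+I$ is translation by $a$. For a 2-space group $\mathrm{M}$ (a discrete group of isometries of $E^2$ with compact quotient), let $N_A(\mathrm{M})$ be its normalizer in the affine group of $E^2$. Each $a+A\in N_A(\mathrm{M})$ induces an affinity $(a+A)_\star:\mathrm{M}x\mapsto\mathrm{M}(a+Ax)$ of the flat orbifold $E^2/\mathrm{M}$; $\mathrm{Aff}(\mathrm{M})$ is the group of all such affinities, and $\mathrm{Sym}(\mathrm{M})=\mathrm{Isom}(E^2/\mathrm{M})$ is its subgroup of isometries of $E^2/\mathrm{M}$. For an affine map $\phi$ with $\phi\mathrm{M}\phi^{-1}=\Delta$, $\phi_\sharp:\mathrm{Aff}(\mathrm{M})\to\mathrm{Aff}(\Delta)$ is defined by $\phi_\sharp((a+A)_\star)=(\phi(a+A)\phi^{-1})_\star$. Here $E^2/\mathrm{M}$ is the square pillow and $E^2/\Delta$ the tetrahedral pillow. *)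

theory Defs
  imports "HOL-Analysis.Analysis" "HOL-Library.FuncSet"
begin

type_synonym pt = "real^2"
type_synonym amap = "pt \<Rightarrow> pt"

text \<open>The affine map a+A : x \<mapsto> a + A x.\<close>
definition aff :: "pt \<Rightarrow> real^2^2 \<Rightarrow> amap" where
  "aff a A = (\<lambda>x. a + A *v x)"

definition e1 :: pt where "e1 = vector [1, 0]"
definition e2 :: pt where "e2 = vector [0, 1]"

text \<open>The affine group of E^2.\<close>
definition affgroup :: "amap set" where
  "affgroup = {aff a A | a A. invertible A}"

text \<open>Subgroup of the affine group generated by a set S of affine maps.\<close>
inductive_set gen :: "amap set \<Rightarrow> amap set" for S where
  gen_id: "id \<in> gen S"
| gen_mult: "g \<in> gen S \<Longrightarrow> s \<in> S \<Longrightarrow> s \<circ> g \<in> gen S"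
| gen_inv: "g \<in> gen S \<Longrightarrow> s \<in> S \<Longrightarrow> inv s \<circ> g \<in> gen S"

text \<open>Affine normalizer N_A(\<Gamma>).\<close>
definition affnorm :: "amap set \<Rightarrow> amap set" where
  "affnorm \<Gamma> = {\<phi> \<in> affgroup. (\<lambda>g. \<phi> \<circ> g \<circ> inv \<phi>) ` \<Gamma> = \<Gamma>}"

text \<open>Orbits; the orbifold E^2/\<Gamma> is the set of orbits.\<close>
definition orbit :: "amap set \<Rightarrow> pt \<Rightarrow> pt set" where
  "orbit \<Gamma> x = (\<lambda>g. g x) ` \<Gamma>"

definition orbits :: "amap set \<Rightarrow> pt set set" where
  "orbits \<Gamma> = range (orbit \<Gamma>)"

text \<open>Induced affinity \<phi>_\<star> : \<Gamma>x \<mapsto> \<Gamma>(\<phi> x), as an extensional map on the orbit set.\<close>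
definition star :: "amap set \<Rightarrow> amap \<Rightarrow> pt set \<Rightarrow> pt set" where
  "star \<Gamma> \<phi> = (\<lambda>Q \<in> orbits \<Gamma>. orbit \<Gamma> (\<phi> (SOME x. x \<in> Q)))"

text \<open>Aff(\<Gamma>).\<close>
definition Aff :: "amap set \<Rightarrow> (pt set \<Rightarrow> pt set) set" where
  "Aff \<Gamma> = star \<Gamma> ` affnorm \<Gamma>"

text \<open>Quotient (orbifold) metric on E^2/\<Gamma>.\<close>
definition orbdist :: "pt set \<Rightarrow> pt set \<Rightarrow> real" where
  "orbdist Q1 Q2 = Inf {dist x y | x y. x \<in> Q1 \<and> y \<in> Q2}"

text \<open>Sym(\<Gamma>): the affinities of E^2/\<Gamma> that are isometries of E^2/\<Gamma>.\<close>
definition Sym :: "amap set \<Rightarrow> (pt set \<Rightarrow> pt set) set" where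
  "Sym \<Gamma> = {f \<in> Aff \<Gamma>. \<forall>Q1 \<in> orbits \<Gamma>. \<forall>Q2 \<in> orbits \<Gamma>.
                 orbdist (f Q1) (f Q2) = orbdist Q1 Q2}"

text \<open>Subgroup generated by a set S of extensional self-maps of a carrier \<Omega>
  (group law: composition restricted to \<Omega>).\<close>
inductive_set gen_on :: "'a set \<Rightarrow> ('a \<Rightarrow> 'a) set \<Rightarrow> ('a \<Rightarrow> 'a) set"
  for \<Omega> S where
  gen_on_id: "(\<lambda>x \<in> \<Omega>. x) \<in> gen_on \<Omega> S"
| gen_on_mult: "g \<in> gen_on \<Omega> S \<Longrightarrow> s \<in> S \<Longrightarrow> compose \<Omega> s g \<in> gen_on \<Omega> S"
| gen_on_inv: "g \<in> gen_on \<Omega> S \<Longrightarrow> s \<in> S \<Longrightarrow>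
     compose \<Omega> (restrict (inv_into \<Omega> s) \<Omega>) g \<in> gen_on \<Omega> S"

text \<open>\<phi>_\<sharp> : Aff(\<Gamma>) \<rightarrow> Aff(\<Delta>), \<phi>_\<sharp>(\<psi>_\<star>) = (\<phi>\<psi>\<phi>^{-1})_\<star>.\<close>
definition sharp :: "amap \<Rightarrow> amap set \<Rightarrow> amap set \<Rightarrow> (pt set \<Rightarrow> pt set) \<Rightarrow> (pt set \<Rightarrow> pt set)" where
  "sharp \<phi> \<Gamma> \<Delta> f = (SOME f'. \<exists>\<psi> \<in> affnorm \<Gamma>. f = star \<Gamma> \<psi> \<and> f' = star \<Delta> (\<phi> \<circ> \<psi> \<circ> inv \<phi>))"

definition Mgrp :: "amap set" where
  "Mgrp = gen {aff e1 (mat 1), aff e2 (mat 1), aff 0 (- mat 1)}"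

definition Deltagrp :: "amap set" where
  "Deltagrp = gen {aff e1 (mat 1), aff (e1 /\<^sub>R 2 + (sqrt 3 / 2) *\<^sub>R e2) (mat 1), aff 0 (- mat 1)}"

definition Kgrp :: "(pt set \<Rightarrow> pt set) set" where
  "Kgrp = gen_on (orbits Mgrp) {star Mgrp (aff (e1 /\<^sub>R 2) (mat 1)), star Mgrp (aff (e2 /\<^sub>R 2) (mat 1))}"

definition matA :: "real^2^2" where "matA = vector [vector [-1, 0], vector [0, 1]]"
definition matB :: "real^2^2" where "matB = vector [vector [-1, 1], vector [0, 1]]"
definition matC :: "real^2^2" where "matC = vector [vector [0, 1], vector [1, 0]]"
definition matD :: "real^2^2" where "matD = vector [vector [1, -1/2], vector [0, sqrt 3 / 2]]"

end

theory Submission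
  imports Defs
begin

text \<open>Both \<open>M\<close> and \<open>\<Delta>\<close> consist of the translations by a lattice \<open>L\<close> and the half-turns
  \<open>x \<mapsto> n - x\<close>, \<open>n \<in> L\<close>, and \<open>D\<close> carries the square lattice onto the hexagonal one, so
  conjugation by \<open>D\<close> transports everything from \<open>M\<close> to \<open>\<Delta>\<close>. The affine normalizer of such a
  group consists of the maps \<open>x \<mapsto> a + A x\<close> with \<open>A L = L\<close> and \<open>2a \<in> L\<close>, and such a map induces
  an isometry of the pillow only if \<open>A\<close> is orthogonal, because near a point of order two short
  displacements are not shortened in the quotient. In square-lattice coordinates the linear
  parts of the symmetries are therefore the integral matrices preserving \<open>x\<^sup>2 + y\<^sup>2\<close>, resp.
  \<open>x\<^sup>2 - x y + y\<^sup>2 = |D (x, y)|\<^sup>2\<close>: up to sign these are the words \<open>I, A, C, AC\<close>, resp.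
  \<open>I, B, C, BC, CB, BCB\<close>. The translation part is a half-lattice vector, which modulo \<open>M\<close> is
  a product of the half-translations generating \<open>K\<close>.\<close>

section \<open>Affine maps, conjugation and normalizers\<close>

text \<open>As a simp rule this also fires on an unapplied \<open>aff a A\<close> by eta-expansion (turning
  \<open>aff 0 A\<close> into \<open>(*v) A\<close>); hence the occasional \<open>del: aff_apply\<close>.\<close>

lemma aff_apply [simp]: "aff a A x = a + A *v x"
  by (simp add: aff_def)

lemma matrix_vector_mult_uminus_left [simp]:
  fixes A :: "'a::comm_ring_1^'n^'m"
  shows "(- A) *v x = - (A *v x)"
  by (simp add: vec_eq_iff matrix_vector_mult_def sum_negf)

lemma matrix_mult_uminus_left [simp]:
  fixes A :: "'a::comm_ring_1^'n^'m" and B :: "'a^'p^'n"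
  shows "(- A) ** B = - (A ** B)"
  by (simp add: vec_eq_iff matrix_matrix_mult_def sum_negf)

lemma matrix_mult_uminus_right [simp]:
  fixes A :: "'a::comm_ring_1^'n^'m" and B :: "'a^'p^'n"
  shows "A ** (- B) = - (A ** B)"
  by (simp add: vec_eq_iff matrix_matrix_mult_def sum_negf)

lemma aff_comp: "aff a A \<circ> aff b B = aff (a + A *v b) (A ** B)"
  by (rule ext) (simp add: matrix_vector_mul_assoc matrix_vector_right_distrib add.assoc)

lemma aff_eq_iff: "aff a A = aff b B \<longleftrightarrow> a = b \<and> A = B"
proof
  assume eq: "aff a A = aff b B"
  from fun_cong[OF eq, of 0] have "a = b" by (simp add: matrix_vector_mult_0_right)
  moreover have "A *v x = B *v x" for x
    using fun_cong[OF eq, of x] \<open>a = b\<close> by (simp del: aff_apply add: aff_def)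
  ultimately show "a = b \<and> A = B" using matrix_eq by blast
qed simp

lemma aff_0_mat_1 [simp]: "aff 0 (mat 1) = id"
  by (rule ext) simp

lemma aff_comp_inverse:
  assumes "A ** A' = mat 1" "A' ** A = mat 1"
  shows "aff a A \<circ> aff (- (A' *v a)) A' = id" "aff (- (A' *v a)) A' \<circ> aff a A = id"
  using assms by (simp_all add: aff_comp matrix_vector_mul_assoc vec.neg)

lemma inv_aff:
  assumes "A ** A' = mat 1" "A' ** A = mat 1"
  shows "inv (aff a A) = aff (- (A' *v a)) A'"
  using inv_unique_comp aff_comp_inverse[OF assms] by blast

lemma aff_in_affgroup: "invertible A \<Longrightarrow> aff a A \<in> affgroup"
  unfolding affgroup_def by blast

lemma id_in_affgroup: "id \<in> affgroup"
  using aff_in_affgroup[of "mat 1" 0] by (simp add: invertible_def)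

lemma affgroup_bij: "\<phi> \<in> affgroup \<Longrightarrow> bij \<phi>"
  unfolding affgroup_def invertible_def using aff_comp_inverse o_bij by blast

lemma affgroup_comp: "\<phi> \<in> affgroup \<Longrightarrow> \<psi> \<in> affgroup \<Longrightarrow> \<phi> \<circ> \<psi> \<in> affgroup"
  unfolding affgroup_def using aff_comp invertible_mult by blast

lemma affgroup_inv: "\<phi> \<in> affgroup \<Longrightarrow> inv \<phi> \<in> affgroup"
  unfolding affgroup_def invertible_def using inv_aff by blast

definition conjugate :: "('a \<Rightarrow> 'a) \<Rightarrow> ('a \<Rightarrow> 'a) \<Rightarrow> 'a \<Rightarrow> 'a" where
  "conjugate P g = P \<circ> g \<circ> inv P"

lemma conjugate_apply: "bij P \<Longrightarrow> conjugate P g (P x) = P (g x)"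
  by (simp add: conjugate_def bij_is_inj)

lemma conjugate_id_left [simp]: "conjugate id g = g"
  by (simp add: conjugate_def)

lemma bij_comp_inv: "bij P \<Longrightarrow> P \<circ> inv P = id"
  using bij_is_surj surj_iff by blast

lemma conjugate_id [simp]: "bij P \<Longrightarrow> conjugate P id = id"
  by (simp add: conjugate_def bij_comp_inv)

lemma conjugate_comp: "bij P \<Longrightarrow> conjugate P (g \<circ> h) = conjugate P g \<circ> conjugate P h"
  by (simp add: conjugate_def comp_assoc bij_is_inj) (simp flip: comp_assoc add: bij_is_inj)

lemma conjugate_conjugate: "bij P \<Longrightarrow> bij Q \<Longrightarrow> conjugate P (conjugate Q g) = conjugate (P \<circ> Q) g"
  by (simp add: conjugate_def o_inv_distrib comp_assoc)

lemma conjugate_inv_conjugate [simp]: "bij P \<Longrightarrow> conjugate (inv P) (conjugate P g) = g"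
  by (simp add: conjugate_conjugate bij_imp_bij_inv bij_is_inj)

lemma conjugate_conjugate_inv [simp]: "bij P \<Longrightarrow> conjugate P (conjugate (inv P) g) = g"
  using conjugate_inv_conjugate[of "inv P" g] by (simp add: bij_imp_bij_inv inv_inv_eq)

lemma bij_conjugate: "bij P \<Longrightarrow> bij g \<Longrightarrow> bij (conjugate P g)"
  unfolding conjugate_def by (intro bij_comp bij_imp_bij_inv)

lemma conjugate_inv: "bij P \<Longrightarrow> bij g \<Longrightarrow> conjugate P (inv g) = inv (conjugate P g)"
  by (rule inv_unique_comp[symmetric])
    (simp_all flip: conjugate_comp add: bij_is_inj bij_comp_inv)

lemma conjugate_affgroup: "P \<in> affgroup \<Longrightarrow> g \<in> affgroup \<Longrightarrow> conjugate P g \<in> affgroup"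
  unfolding conjugate_def by (intro affgroup_comp affgroup_inv)

definition affine_subgroup :: "amap set \<Rightarrow> bool" where
  "affine_subgroup \<Gamma> \<longleftrightarrow> \<Gamma> \<subseteq> affgroup \<and> id \<in> \<Gamma> \<and>
     (\<forall>g\<in>\<Gamma>. \<forall>h\<in>\<Gamma>. g \<circ> h \<in> \<Gamma>) \<and> (\<forall>g\<in>\<Gamma>. inv g \<in> \<Gamma>)"

lemma affine_subgroupD:
  assumes "affine_subgroup \<Gamma>"
  shows "id \<in> \<Gamma>" "g \<in> \<Gamma> \<Longrightarrow> h \<in> \<Gamma> \<Longrightarrow> g \<circ> h \<in> \<Gamma>" "g \<in> \<Gamma> \<Longrightarrow> inv g \<in> \<Gamma>"
    "g \<in> \<Gamma> \<Longrightarrow> g \<in> affgroup" "g \<in> \<Gamma> \<Longrightarrow> bij g"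
  using assms affgroup_bij unfolding affine_subgroup_def by auto

lemma affine_subgroup_conjugate:
  assumes P: "P \<in> affgroup" and \<Gamma>: "affine_subgroup \<Gamma>"
  shows "affine_subgroup (conjugate P ` \<Gamma>)"
  unfolding affine_subgroup_def
proof (intro conjI ballI)
  have bP: "bij P" using P affgroup_bij by blast
  show "conjugate P ` \<Gamma> \<subseteq> affgroup" using P \<Gamma> conjugate_affgroup affine_subgroupD(4) by blast
  show "id \<in> conjugate P ` \<Gamma>" using bP \<Gamma> affine_subgroupD(1) by force
  show "g \<circ> h \<in> conjugate P ` \<Gamma>" if "g \<in> conjugate P ` \<Gamma>" "h \<in> conjugate P ` \<Gamma>" for g h
    using that bP \<Gamma> affine_subgroupD(2) by (auto simp flip: conjugate_comp)
  show "inv g \<in> conjugate P ` \<Gamma>" if "g \<in> conjugate P ` \<Gamma>" for g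
    using that bP \<Gamma> affine_subgroupD(3,5) by (auto simp flip: conjugate_inv)
qed

lemma affnorm_iff: "\<phi> \<in> affnorm \<Gamma> \<longleftrightarrow> \<phi> \<in> affgroup \<and> conjugate \<phi> ` \<Gamma> = \<Gamma>"
  unfolding affnorm_def conjugate_def[abs_def] by simp

lemma affnorm_conjugate_mem: "\<phi> \<in> affnorm \<Gamma> \<Longrightarrow> g \<in> \<Gamma> \<Longrightarrow> conjugate \<phi> g \<in> \<Gamma>"
  unfolding affnorm_iff by blast

lemma affnorm_affgroup: "\<phi> \<in> affnorm \<Gamma> \<Longrightarrow> \<phi> \<in> affgroup"
  unfolding affnorm_iff by blast

lemma affnorm_bij: "\<phi> \<in> affnorm \<Gamma> \<Longrightarrow> bij \<phi>"
  using affnorm_affgroup affgroup_bij by blast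

lemma id_in_affnorm: "id \<in> affnorm \<Gamma>"
  unfolding affnorm_iff using id_in_affgroup by simp

lemma affnorm_comp:
  assumes "\<phi> \<in> affnorm \<Gamma>" "\<psi> \<in> affnorm \<Gamma>"
  shows "\<phi> \<circ> \<psi> \<in> affnorm \<Gamma>"
proof -
  have "conjugate (\<phi> \<circ> \<psi>) ` \<Gamma> = conjugate \<phi> ` conjugate \<psi> ` \<Gamma>"
    using assms affnorm_bij by (simp add: image_image conjugate_conjugate)
  then show ?thesis using assms affgroup_comp unfolding affnorm_iff by simp
qed

lemma affnorm_inv:
  assumes "\<phi> \<in> affnorm \<Gamma>"
  shows "inv \<phi> \<in> affnorm \<Gamma>"
proof -
  have "conjugate (inv \<phi>) ` \<Gamma> = conjugate (inv \<phi>) ` conjugate \<phi> ` \<Gamma>"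
    using assms unfolding affnorm_iff by simp
  also have "\<dots> = \<Gamma>"
    using affnorm_bij[OF assms] by (simp add: image_image)
  finally show ?thesis using assms affgroup_inv unfolding affnorm_iff by simp
qed

lemma affine_subgroup_subset_affnorm:
  assumes \<Gamma>: "affine_subgroup \<Gamma>" and g: "g \<in> \<Gamma>"
  shows "g \<in> affnorm \<Gamma>"
proof -
  have closed: "conjugate h ` \<Gamma> \<subseteq> \<Gamma>" if "h \<in> \<Gamma>" for h
    using that \<Gamma> affine_subgroupD(2,3) unfolding conjugate_def by blast
  have "\<Gamma> = conjugate g ` conjugate (inv g) ` \<Gamma>"
    using g \<Gamma> affine_subgroupD(5) by (simp add: image_image)
  then have "\<Gamma> \<subseteq> conjugate g ` \<Gamma>"
    using closed[of "inv g"] g \<Gamma> affine_subgroupD(3) by blast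
  then show ?thesis using closed[OF g] g \<Gamma> affine_subgroupD(4) unfolding affnorm_iff by blast
qed

lemma affnorm_conjugate:
  assumes P: "P \<in> affgroup" and \<psi>: "\<psi> \<in> affnorm \<Gamma>"
  shows "conjugate P \<psi> \<in> affnorm (conjugate P ` \<Gamma>)"
proof -
  have bP: "bij P" and b\<psi>: "bij \<psi>" using P \<psi> affgroup_bij affnorm_bij by auto
  have "conjugate (conjugate P \<psi>) (conjugate P g) = conjugate P (conjugate \<psi> g)" for g
  proof -
    have "conjugate P \<psi> \<circ> P = P \<circ> \<psi>"
      by (simp add: conjugate_def comp_assoc bij_is_inj bP)
    then show ?thesis
      by (metis bP b\<psi> bij_conjugate conjugate_conjugate)
  qed
  then have "conjugate (conjugate P \<psi>) ` conjugate P ` \<Gamma> = conjugate P ` conjugate \<psi> ` \<Gamma>"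
    by (simp add: image_image)
  then show ?thesis
    using \<psi> P conjugate_affgroup affnorm_affgroup unfolding affnorm_iff by simp
qed

lemma affnorm_conjugate_image:
  assumes P: "P \<in> affgroup"
  shows "affnorm (conjugate P ` \<Gamma>) = conjugate P ` affnorm \<Gamma>"
proof
  show "conjugate P ` affnorm \<Gamma> \<subseteq> affnorm (conjugate P ` \<Gamma>)"
    using affnorm_conjugate[OF P] by blast
  have bP: "bij P" using P affgroup_bij by blast
  show "affnorm (conjugate P ` \<Gamma>) \<subseteq> conjugate P ` affnorm \<Gamma>"
  proof
    fix \<phi> assume "\<phi> \<in> affnorm (conjugate P ` \<Gamma>)"
    then have "conjugate (inv P) \<phi> \<in> affnorm (conjugate (inv P) ` conjugate P ` \<Gamma>)"
      using affnorm_conjugate[OF affgroup_inv[OF P]] by blast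
    then have "conjugate (inv P) \<phi> \<in> affnorm \<Gamma>"
      using bP by (simp add: image_image)
    then show "\<phi> \<in> conjugate P ` affnorm \<Gamma>"
      using bP by (metis conjugate_conjugate_inv image_eqI)
  qed
qed

section \<open>Orbits and induced affinities\<close>

lemma orbit_self: "affine_subgroup \<Gamma> \<Longrightarrow> x \<in> orbit \<Gamma> x"
  unfolding orbit_def by (metis affine_subgroupD(1) id_apply image_eqI)

lemma orbit_in_orbits [simp]: "orbit \<Gamma> x \<in> orbits \<Gamma>"
  unfolding orbits_def by simp

lemma orbit_affnorm_apply:
  assumes \<Gamma>: "affine_subgroup \<Gamma>" and \<phi>: "\<phi> \<in> affnorm \<Gamma>"
  shows "orbit \<Gamma> (\<phi> x) = \<phi> ` orbit \<Gamma> x"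
proof -
  have "conjugate \<phi> g (\<phi> x) = \<phi> (g x)" for g
    using affnorm_bij[OF \<phi>] by (rule conjugate_apply)
  then have "orbit (conjugate \<phi> ` \<Gamma>) (\<phi> x) = \<phi> ` orbit \<Gamma> x"
    unfolding orbit_def by (simp add: image_image)
  then show ?thesis using \<phi> unfolding affnorm_iff by simp
qed

lemma orbit_group_apply:
  assumes \<Gamma>: "affine_subgroup \<Gamma>" and g: "g \<in> \<Gamma>"
  shows "orbit \<Gamma> (g x) = orbit \<Gamma> x"
proof
  show "orbit \<Gamma> (g x) \<subseteq> orbit \<Gamma> x"
    unfolding orbit_def using g affine_subgroupD(2)[OF \<Gamma>] by (auto intro!: image_eqI[of _ _ "_ \<circ> g"])
  have "h x = (h \<circ> inv g) (g x)" for h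
    using g affine_subgroupD(5)[OF \<Gamma>] by (simp add: bij_is_inj)
  then show "orbit \<Gamma> x \<subseteq> orbit \<Gamma> (g x)"
    unfolding orbit_def using g affine_subgroupD(2,3)[OF \<Gamma>] by blast
qed

lemma star_orbit:
  assumes \<Gamma>: "affine_subgroup \<Gamma>" and \<phi>: "\<phi> \<in> affnorm \<Gamma>"
  shows "star \<Gamma> \<phi> (orbit \<Gamma> x) = orbit \<Gamma> (\<phi> x)"
proof -
  have "(SOME y. y \<in> orbit \<Gamma> x) \<in> orbit \<Gamma> x"
    using orbit_self[OF \<Gamma>] by (rule someI)
  then obtain g where "g \<in> \<Gamma>" "(SOME y. y \<in> orbit \<Gamma> x) = g x"
    unfolding orbit_def by blast
  then show ?thesis
    using \<Gamma> \<phi> by (simp add: star_def orbit_affnorm_apply orbit_group_apply)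
qed

lemma star_in_orbits: "Q \<in> orbits \<Gamma> \<Longrightarrow> star \<Gamma> \<phi> Q \<in> orbits \<Gamma>"
  unfolding star_def by simp

lemma star_eqI:
  assumes "\<And>x. star \<Gamma> \<phi> (orbit \<Gamma> x) = star \<Gamma> \<psi> (orbit \<Gamma> x)"
  shows "star \<Gamma> \<phi> = star \<Gamma> \<psi>"
  using assms unfolding star_def orbits_def by (auto intro!: extensionalityI[where A = "range (orbit \<Gamma>)"])

lemma star_comp:
  assumes \<Gamma>: "affine_subgroup \<Gamma>" and "\<phi> \<in> affnorm \<Gamma>" "\<psi> \<in> affnorm \<Gamma>"
  shows "star \<Gamma> (\<phi> \<circ> \<psi>) = compose (orbits \<Gamma>) (star \<Gamma> \<phi>) (star \<Gamma> \<psi>)"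
proof (rule extensionalityI[where A = "orbits \<Gamma>"])
  show "star \<Gamma> (\<phi> \<circ> \<psi>) \<in> extensional (orbits \<Gamma>)" by (simp add: star_def)
  show "compose (orbits \<Gamma>) (star \<Gamma> \<phi>) (star \<Gamma> \<psi>) \<in> extensional (orbits \<Gamma>)"
    by (simp add: compose_def)
  show "star \<Gamma> (\<phi> \<circ> \<psi>) Q = compose (orbits \<Gamma>) (star \<Gamma> \<phi>) (star \<Gamma> \<psi>) Q" if "Q \<in> orbits \<Gamma>" for Q
    using that assms affnorm_comp unfolding orbits_def by (auto simp: star_orbit compose_def)
qed

lemma star_id:
  assumes "affine_subgroup \<Gamma>"
  shows "star \<Gamma> id = (\<lambda>Q \<in> orbits \<Gamma>. Q)"
proof (rule extensionalityI[where A = "orbits \<Gamma>"])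
  show "star \<Gamma> id Q = (\<lambda>Q \<in> orbits \<Gamma>. Q) Q" if "Q \<in> orbits \<Gamma>" for Q
    using that star_orbit[OF assms id_in_affnorm] unfolding orbits_def by auto
qed (simp_all add: star_def)

lemma star_inv:
  assumes \<Gamma>: "affine_subgroup \<Gamma>" and \<phi>: "\<phi> \<in> affnorm \<Gamma>"
  shows "restrict (inv_into (orbits \<Gamma>) (star \<Gamma> \<phi>)) (orbits \<Gamma>) = star \<Gamma> (inv \<phi>)"
proof (rule extensionalityI[where A = "orbits \<Gamma>"])
  have b: "bij \<phi>" and i: "inv \<phi> \<in> affnorm \<Gamma>" using \<phi> affnorm_bij affnorm_inv by auto
  have left: "star \<Gamma> (inv \<phi>) (star \<Gamma> \<phi> Q) = Q" and right: "star \<Gamma> \<phi> (star \<Gamma> (inv \<phi>) Q) = Q"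
    if "Q \<in> orbits \<Gamma>" for Q
    using that \<Gamma> \<phi> i b unfolding orbits_def by (auto simp: star_orbit bij_is_inj bij_is_surj surj_f_inv_f)
  have inj: "inj_on (star \<Gamma> \<phi>) (orbits \<Gamma>)" using left by (metis inj_onI)
  show "restrict (inv_into (orbits \<Gamma>) (star \<Gamma> \<phi>)) (orbits \<Gamma>) Q = star \<Gamma> (inv \<phi>) Q"
    if "Q \<in> orbits \<Gamma>" for Q
    using inv_into_f_eq[OF inj star_in_orbits[OF that] right[OF that]] that by simp
qed (simp_all add: star_def)

lemma star_absorb_left:
  assumes \<Gamma>: "affine_subgroup \<Gamma>" and "g \<in> \<Gamma>" "\<phi> \<in> affnorm \<Gamma>"
  shows "star \<Gamma> (g \<circ> \<phi>) = star \<Gamma> \<phi>"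
  using assms affine_subgroup_subset_affnorm affnorm_comp
  by (intro star_eqI) (simp add: star_orbit orbit_group_apply)

lemma star_absorb_right:
  assumes \<Gamma>: "affine_subgroup \<Gamma>" and g: "g \<in> \<Gamma>" and \<phi>: "\<phi> \<in> affnorm \<Gamma>"
  shows "star \<Gamma> (\<phi> \<circ> g) = star \<Gamma> \<phi>"
proof (rule star_eqI)
  fix x
  have "orbit \<Gamma> (\<phi> (g x)) = \<phi> ` orbit \<Gamma> (g x)" using orbit_affnorm_apply[OF \<Gamma> \<phi>] .
  also have "\<dots> = orbit \<Gamma> (\<phi> x)" using orbit_affnorm_apply[OF \<Gamma> \<phi>] orbit_group_apply[OF \<Gamma> g] by simp
  finally show "star \<Gamma> (\<phi> \<circ> g) (orbit \<Gamma> x) = star \<Gamma> \<phi> (orbit \<Gamma> x)"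
    using \<Gamma> g \<phi> affine_subgroup_subset_affnorm affnorm_comp by (simp add: star_orbit)
qed

lemma star_conjugate_orbit:
  assumes P: "P \<in> affgroup" and \<Gamma>: "affine_subgroup \<Gamma>" and \<psi>: "\<psi> \<in> affnorm \<Gamma>"
  shows "star (conjugate P ` \<Gamma>) (conjugate P \<psi>) (orbit (conjugate P ` \<Gamma>) (P x))
    = P ` star \<Gamma> \<psi> (orbit \<Gamma> x)"
proof -
  have bP: "bij P" using P affgroup_bij by blast
  have orbit_P: "orbit (conjugate P ` \<Gamma>) (P y) = P ` orbit \<Gamma> y" for y
    unfolding orbit_def using bP by (simp add: image_image conjugate_apply)
  have "star (conjugate P ` \<Gamma>) (conjugate P \<psi>) (orbit (conjugate P ` \<Gamma>) (P x))
      = orbit (conjugate P ` \<Gamma>) (conjugate P \<psi> (P x))"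
    using star_orbit[OF affine_subgroup_conjugate[OF P \<Gamma>] affnorm_conjugate[OF P \<psi>]] .
  also have "\<dots> = P ` orbit \<Gamma> (\<psi> x)" by (simp add: conjugate_apply[OF bP] orbit_P)
  finally show ?thesis by (simp add: star_orbit[OF \<Gamma> \<psi>])
qed

lemma star_conjugate_eq_iff:
  assumes P: "P \<in> affgroup" and \<Gamma>: "affine_subgroup \<Gamma>" and "\<psi>1 \<in> affnorm \<Gamma>" "\<psi>2 \<in> affnorm \<Gamma>"
  shows "star (conjugate P ` \<Gamma>) (conjugate P \<psi>1) = star (conjugate P ` \<Gamma>) (conjugate P \<psi>2)
    \<longleftrightarrow> star \<Gamma> \<psi>1 = star \<Gamma> \<psi>2"
proof
  have bP: "bij P" using P affgroup_bij by blast
  note transport = star_conjugate_orbit[OF P \<Gamma> assms(3)] star_conjugate_orbit[OF P \<Gamma> assms(4)]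
  show "star \<Gamma> \<psi>1 = star \<Gamma> \<psi>2"
    if "star (conjugate P ` \<Gamma>) (conjugate P \<psi>1) = star (conjugate P ` \<Gamma>) (conjugate P \<psi>2)"
    using that transport bP by (intro star_eqI) (metis bij_is_inj inj_image_eq_iff)
  show "star (conjugate P ` \<Gamma>) (conjugate P \<psi>1) = star (conjugate P ` \<Gamma>) (conjugate P \<psi>2)"
    if "star \<Gamma> \<psi>1 = star \<Gamma> \<psi>2"
  proof (rule star_eqI)
    fix y
    have "y = P (inv P y)" using bP by (simp add: bij_is_surj surj_f_inv_f)
    then show "star (conjugate P ` \<Gamma>) (conjugate P \<psi>1) (orbit (conjugate P ` \<Gamma>) y)
      = star (conjugate P ` \<Gamma>) (conjugate P \<psi>2) (orbit (conjugate P ` \<Gamma>) y)"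
      using that transport by metis
  qed
qed

lemma sharp_star:
  assumes P: "P \<in> affgroup" and \<Gamma>: "affine_subgroup \<Gamma>" and \<psi>: "\<psi> \<in> affnorm \<Gamma>"
  shows "sharp P \<Gamma> (conjugate P ` \<Gamma>) (star \<Gamma> \<psi>) = star (conjugate P ` \<Gamma>) (conjugate P \<psi>)"
  unfolding sharp_def conjugate_def[symmetric]
proof (rule some_equality)
  show "\<exists>\<psi>'\<in>affnorm \<Gamma>. star \<Gamma> \<psi> = star \<Gamma> \<psi>' \<and>
      star (conjugate P ` \<Gamma>) (conjugate P \<psi>) = star (conjugate P ` \<Gamma>) (conjugate P \<psi>')"
    using \<psi> by blast
  show "f = star (conjugate P ` \<Gamma>) (conjugate P \<psi>)"
    if "\<exists>\<psi>'\<in>affnorm \<Gamma>. star \<Gamma> \<psi> = star \<Gamma> \<psi>' \<and> f = star (conjugate P ` \<Gamma>) (conjugate P \<psi>')" for f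
    using that star_conjugate_eq_iff[OF P \<Gamma> \<psi>] by metis
qed

lemma bij_betw_sharp:
  assumes P: "P \<in> affgroup" and \<Gamma>: "affine_subgroup \<Gamma>"
  shows "bij_betw (sharp P \<Gamma> (conjugate P ` \<Gamma>)) (Aff \<Gamma>) (Aff (conjugate P ` \<Gamma>))"
proof (rule bij_betw_imageI)
  show "inj_on (sharp P \<Gamma> (conjugate P ` \<Gamma>)) (Aff \<Gamma>)"
    unfolding Aff_def using sharp_star[OF P \<Gamma>] star_conjugate_eq_iff[OF P \<Gamma>]
    by (auto intro!: inj_onI)
  have "sharp P \<Gamma> (conjugate P ` \<Gamma>) ` Aff \<Gamma> = star (conjugate P ` \<Gamma>) ` conjugate P ` affnorm \<Gamma>"
    unfolding Aff_def image_image using sharp_star[OF P \<Gamma>] by simp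
  then show "sharp P \<Gamma> (conjugate P ` \<Gamma>) ` Aff \<Gamma> = Aff (conjugate P ` \<Gamma>)"
    unfolding Aff_def affnorm_conjugate_image[OF P] .
qed

lemma sharp_compose:
  assumes P: "P \<in> affgroup" and \<Gamma>: "affine_subgroup \<Gamma>" and "f \<in> Aff \<Gamma>" "h \<in> Aff \<Gamma>"
  shows "sharp P \<Gamma> (conjugate P ` \<Gamma>) (compose (orbits \<Gamma>) f h)
    = compose (orbits (conjugate P ` \<Gamma>)) (sharp P \<Gamma> (conjugate P ` \<Gamma>) f) (sharp P \<Gamma> (conjugate P ` \<Gamma>) h)"
proof -
  obtain \<phi> \<psi> where \<phi>: "\<phi> \<in> affnorm \<Gamma>" "f = star \<Gamma> \<phi>" and \<psi>: "\<psi> \<in> affnorm \<Gamma>" "h = star \<Gamma> \<psi>"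
    using assms(3,4) unfolding Aff_def by blast
  have bP: "bij P" using P affgroup_bij by blast
  have "compose (orbits \<Gamma>) f h = star \<Gamma> (\<phi> \<circ> \<psi>)"
    using star_comp[OF \<Gamma> \<phi>(1) \<psi>(1)] \<phi> \<psi> by simp
  then show ?thesis
    using \<phi> \<psi> affnorm_comp affnorm_conjugate[OF P]
    by (simp add: sharp_star[OF P \<Gamma>] conjugate_comp[OF bP]
        star_comp[OF affine_subgroup_conjugate[OF P \<Gamma>]])
qed

definition isometry :: "amap \<Rightarrow> bool" where
  "isometry f \<longleftrightarrow> (\<forall>x y. dist (f x) (f y) = dist x y)"

lemma isometry_comp: "isometry f \<Longrightarrow> isometry g \<Longrightarrow> isometry (f \<circ> g)"
  unfolding isometry_def by simp

lemma isometry_inv: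
  assumes "bij f" "isometry f"
  shows "isometry (inv f)"
  unfolding isometry_def
proof (intro allI)
  fix x y
  have "dist (inv f x) (inv f y) = dist (f (inv f x)) (f (inv f y))"
    using assms(2) unfolding isometry_def by simp
  then show "dist (inv f x) (inv f y) = dist x y"
    using assms(1) by (simp add: bij_is_surj surj_f_inv_f)
qed

lemma isometry_aff_iff: "isometry (aff a A) \<longleftrightarrow> (\<forall>v. norm (A *v v) = norm v)"
proof
  show "\<forall>v. norm (A *v v) = norm v" if "isometry (aff a A)"
  proof
    fix v
    have "dist (aff a A v) (aff a A 0) = dist v 0"
      using that unfolding isometry_def by blast
    then show "norm (A *v v) = norm v" by (simp add: dist_norm matrix_vector_mult_0_right)
  qed
  show "isometry (aff a A)" if "\<forall>v. norm (A *v v) = norm v"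
    using that unfolding isometry_def dist_norm by (simp flip: matrix_vector_mult_diff_distrib)
qed

lemma orbdist_star_isometry:
  assumes \<Gamma>: "affine_subgroup \<Gamma>" and \<phi>: "\<phi> \<in> affnorm \<Gamma>" "isometry \<phi>"
    and "Q1 \<in> orbits \<Gamma>" "Q2 \<in> orbits \<Gamma>"
  shows "orbdist (star \<Gamma> \<phi> Q1) (star \<Gamma> \<phi> Q2) = orbdist Q1 Q2"
proof -
  have image: "star \<Gamma> \<phi> Q = \<phi> ` Q" if "Q \<in> orbits \<Gamma>" for Q
    using that \<Gamma> \<phi>(1) unfolding orbits_def by (auto simp: star_orbit orbit_affnorm_apply)
  have "{dist u w |u w. u \<in> \<phi> ` Q1 \<and> w \<in> \<phi> ` Q2} = {dist (\<phi> u) (\<phi> w) |u w. u \<in> Q1 \<and> w \<in> Q2}"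
    by auto
  also have "\<dots> = {dist u w |u w. u \<in> Q1 \<and> w \<in> Q2}"
    using \<phi>(2) unfolding isometry_def by simp
  finally show ?thesis
    unfolding orbdist_def image[OF assms(4)] image[OF assms(5)] by simp
qed

section \<open>Half-turn groups of lattices\<close>

lemma conjugate_aff:
  assumes "A ** A' = mat 1" "A' ** A = mat 1"
  shows "conjugate (aff a A) (aff b B) = aff (a + A *v b - (A ** B ** A') *v a) (A ** B ** A')"
  by (simp add: conjugate_def inv_aff[OF assms] aff_comp vec.neg matrix_vector_mul_assoc)

definition add_subgroup :: "pt set \<Rightarrow> bool" where
  "add_subgroup L \<longleftrightarrow> 0 \<in> L \<and> (\<forall>x\<in>L. \<forall>y\<in>L. x + y \<in> L) \<and> (\<forall>x\<in>L. - x \<in> L)"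

lemma add_subgroupD:
  assumes "add_subgroup L"
  shows "0 \<in> L" "x \<in> L \<Longrightarrow> y \<in> L \<Longrightarrow> x + y \<in> L" "x \<in> L \<Longrightarrow> - x \<in> L"
    "x \<in> L \<Longrightarrow> y \<in> L \<Longrightarrow> x - y \<in> L"
  using assms unfolding add_subgroup_def
  by (auto simp del: add_uminus_conv_diff simp add: diff_conv_add_uminus)

lemma add_subgroup_int_multiple:
  assumes L: "add_subgroup L" and u: "u \<in> L"
  shows "of_int i *\<^sub>R u \<in> L"
proof -
  have "of_nat n *\<^sub>R u \<in> L" for n
    by (induction n) (simp_all add: add_subgroupD[OF L] u algebra_simps)
  then show ?thesis
    by (cases i rule: int_cases2) (auto simp: add_subgroupD(3)[OF L])
qed

definition int_lattice :: "pt \<Rightarrow> pt \<Rightarrow> pt set" where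
  "int_lattice u v = {of_int i *\<^sub>R u + of_int j *\<^sub>R v | i j. True}"

lemma mem_int_lattice: "x \<in> int_lattice u v \<longleftrightarrow> (\<exists>i j. x = of_int i *\<^sub>R u + of_int j *\<^sub>R v)"
  by (simp add: int_lattice_def)

lemma add_subgroup_int_lattice: "add_subgroup (int_lattice u v)"
  unfolding add_subgroup_def
proof (intro conjI ballI)
  show "0 \<in> int_lattice u v"
    unfolding mem_int_lattice by (rule exI[of _ 0], rule exI[of _ 0]) simp
  show "x + y \<in> int_lattice u v" if x: "x \<in> int_lattice u v" and y: "y \<in> int_lattice u v" for x y
  proof -
    obtain i j k l where "x = of_int i *\<^sub>R u + of_int j *\<^sub>R v" "y = of_int k *\<^sub>R u + of_int l *\<^sub>R v"
      using x y unfolding mem_int_lattice by blast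
    then have "x + y = of_int (i + k) *\<^sub>R u + of_int (j + l) *\<^sub>R v" by (simp add: algebra_simps)
    then show ?thesis unfolding mem_int_lattice by blast
  qed
  show "- x \<in> int_lattice u v" if x: "x \<in> int_lattice u v" for x
  proof -
    obtain i j where "x = of_int i *\<^sub>R u + of_int j *\<^sub>R v" using x unfolding mem_int_lattice by blast
    then have "- x = of_int (- i) *\<^sub>R u + of_int (- j) *\<^sub>R v" by (simp add: algebra_simps)
    then show ?thesis unfolding mem_int_lattice by blast
  qed
qed

lemma int_lattice_subset:
  assumes "add_subgroup L" "u \<in> L" "v \<in> L"
  shows "int_lattice u v \<subseteq> L"
  unfolding int_lattice_def using assms add_subgroup_int_multiple add_subgroupD(2) by blast

lemma int_lattice_generators: "u \<in> int_lattice u v" "v \<in> int_lattice u v"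
  unfolding int_lattice_def
  by (rule CollectI, rule exI[of _ 1], rule exI[of _ 0], simp)
    (rule CollectI, rule exI[of _ 0], rule exI[of _ 1], simp)

text \<open>For a lattice \<open>L\<close> the quotient of \<open>E\<^sup>2\<close> by this group is a pillowcase: the square pillow
  for \<open>M\<close>, the tetrahedral pillow for \<open>\<Delta>\<close>.\<close>

definition half_turn_group :: "pt set \<Rightarrow> amap set" where
  "half_turn_group L = (\<lambda>n. aff n (mat 1)) ` L \<union> (\<lambda>n. aff n (- mat 1)) ` L"

lemma mat_1_neq_uminus: "mat 1 \<noteq> (- mat 1 :: real^2^2)"
proof
  assume "mat 1 = (- mat 1 :: real^2^2)"
  then have "(mat 1 :: real^2^2) $ 1 $ 1 = (- mat 1 :: real^2^2) $ 1 $ 1" by (rule arg_cong)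
  then show False unfolding vector_uminus_component mat_def by simp
qed

lemma translation_in_half_turn_group_iff [simp]: "aff m (mat 1) \<in> half_turn_group L \<longleftrightarrow> m \<in> L"
  unfolding half_turn_group_def using mat_1_neq_uminus by (auto simp: aff_eq_iff)

lemma half_turn_in_half_turn_group_iff [simp]: "aff m (- mat 1) \<in> half_turn_group L \<longleftrightarrow> m \<in> L"
  unfolding half_turn_group_def using mat_1_neq_uminus by (auto simp: aff_eq_iff)

lemma invertible_mat_1: "invertible (mat 1 :: real^2^2)"
  unfolding invertible_def by (rule exI[of _ "mat 1"]) simp

lemma invertible_uminus_mat_1: "invertible (- mat 1 :: real^2^2)"
  unfolding invertible_def by (rule exI[of _ "- mat 1"]) simp

lemma inv_half_turn [simp]: "inv (aff n (- mat 1)) = aff n (- mat 1)"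
  using inv_aff[of "- mat 1" "- mat 1" n] by simp

lemma inv_translation [simp]: "inv (aff n (mat 1)) = aff (- n) (mat 1)"
  using inv_aff[of "mat 1" "mat 1" n] by simp

lemma affine_subgroup_half_turn_group:
  assumes L: "add_subgroup L"
  shows "affine_subgroup (half_turn_group L)"
  unfolding affine_subgroup_def
proof (intro conjI ballI)
  show "half_turn_group L \<subseteq> affgroup"
    unfolding half_turn_group_def using aff_in_affgroup invertible_mat_1 invertible_uminus_mat_1
    by blast
  show "id \<in> half_turn_group L"
    using translation_in_half_turn_group_iff[of 0] add_subgroupD(1)[OF L] by simp
  show "g \<circ> h \<in> half_turn_group L" if "g \<in> half_turn_group L" "h \<in> half_turn_group L" for g h
    using that unfolding half_turn_group_def by (auto simp: aff_comp add_subgroupD[OF L])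
  show "inv g \<in> half_turn_group L" if "g \<in> half_turn_group L" for g
    using that unfolding half_turn_group_def by (auto simp: add_subgroupD[OF L])
qed

lemma gen_mem: "s \<in> S \<Longrightarrow> s \<in> gen S"
  using gen.gen_mult[OF gen.gen_id] by simp

lemma gen_comp: "g \<in> gen S \<Longrightarrow> h \<in> gen S \<Longrightarrow> g \<circ> h \<in> gen S"
  by (induction g rule: gen.induct) (auto simp: comp_assoc intro: gen.intros)

lemma gen_subset:
  assumes "affine_subgroup \<Gamma>" "S \<subseteq> \<Gamma>"
  shows "gen S \<subseteq> \<Gamma>"
proof
  show "g \<in> \<Gamma>" if "g \<in> gen S" for g
    using that by induction (use assms affine_subgroupD[OF assms(1)] in blast)+
qed

lemma gen_eq_half_turn_group:
  "gen {aff u (mat 1), aff v (mat 1), aff 0 (- mat 1)} = half_turn_group (int_lattice u v)"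
  (is "gen ?S = _")
proof
  show "gen ?S \<subseteq> half_turn_group (int_lattice u v)"
    using affine_subgroup_half_turn_group add_subgroup_int_lattice int_lattice_generators
      add_subgroupD(1)[OF add_subgroup_int_lattice]
    by (intro gen_subset) auto
  have half_turn: "aff 0 (- mat 1) \<in> gen ?S" by (simp add: gen_mem)
  define T where "T = {n. aff n (mat 1) \<in> gen ?S}"
  have "add_subgroup T"
    unfolding add_subgroup_def T_def
  proof (intro conjI ballI; simp)
    show "id \<in> gen ?S" by (rule gen.gen_id)
    show "aff (x + y) (mat 1) \<in> gen ?S" if "aff x (mat 1) \<in> gen ?S" "aff y (mat 1) \<in> gen ?S" for x y
      using gen_comp[OF that] by (simp add: aff_comp)
    show "aff (- x) (mat 1) \<in> gen ?S" if "aff x (mat 1) \<in> gen ?S" for x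
      using gen_comp[OF gen_comp[OF half_turn that] half_turn] by (simp add: aff_comp)
  qed
  then have T: "int_lattice u v \<subseteq> T"
    by (rule int_lattice_subset) (simp_all add: T_def gen_mem)
  show "half_turn_group (int_lattice u v) \<subseteq> gen ?S"
  proof
    fix g assume "g \<in> half_turn_group (int_lattice u v)"
    then obtain n where n: "n \<in> int_lattice u v" "g = aff n (mat 1) \<or> g = aff n (- mat 1)"
      unfolding half_turn_group_def by blast
    have "- n \<in> int_lattice u v" using n(1) add_subgroupD(3)[OF add_subgroup_int_lattice] by blast
    then have "aff 0 (- mat 1) \<circ> aff (- n) (mat 1) \<in> gen ?S"
      using T gen_comp[OF half_turn] unfolding T_def by blast
    moreover have "aff 0 (- mat 1) \<circ> aff (- n) (mat 1) = aff n (- mat 1)" by (simp add: aff_comp)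
    ultimately show "g \<in> gen ?S"
      using n T unfolding T_def by auto
  qed
qed

lemma conjugate_half_turn_group_subset:
  assumes L: "add_subgroup L" and A: "A ** A' = mat 1" "A' ** A = mat 1"
    and AL: "\<And>n. n \<in> L \<Longrightarrow> A *v n \<in> L" and a: "2 *\<^sub>R a \<in> L"
  shows "conjugate (aff a A) ` half_turn_group L \<subseteq> half_turn_group L"
  unfolding half_turn_group_def using AL a A
  by (auto simp: conjugate_aff[OF A] scaleR_2 add.assoc add_subgroupD[OF L])

lemma affnorm_half_turn_groupE:
  assumes L: "add_subgroup L" and \<phi>: "\<phi> \<in> affnorm (half_turn_group L)"
  obtains a A where "\<phi> = aff a A" "invertible A" "\<And>n. n \<in> L \<Longrightarrow> A *v n \<in> L" "2 *\<^sub>R a \<in> L"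
proof -
  obtain a A where \<phi>A: "\<phi> = aff a A" "invertible A"
    using affnorm_affgroup[OF \<phi>] unfolding affgroup_def by blast
  then obtain A' where A: "A ** A' = mat 1" "A' ** A = mat 1" unfolding invertible_def by blast
  have "A *v n \<in> L" if "n \<in> L" for n
    using affnorm_conjugate_mem[OF \<phi>, of "aff n (mat 1)"] that \<phi>A by (simp add: conjugate_aff[OF A] A)
  moreover have "2 *\<^sub>R a \<in> L"
    using affnorm_conjugate_mem[OF \<phi>, of "aff 0 (- mat 1)"] add_subgroupD(1)[OF L] \<phi>A
    by (simp add: conjugate_aff[OF A] A scaleR_2)
  ultimately show ?thesis using that \<phi>A by blast
qed

lemma aff_in_affnorm_half_turn_group:
  assumes L: "add_subgroup L" and A: "A ** A' = mat 1" "A' ** A = mat 1"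
    and AL: "\<And>n. n \<in> L \<Longrightarrow> A *v n \<in> L" and A'L: "\<And>n. n \<in> L \<Longrightarrow> A' *v n \<in> L"
    and a: "2 *\<^sub>R a \<in> L"
  shows "aff a A \<in> affnorm (half_turn_group L)"
proof -
  have inv_a: "2 *\<^sub>R (- (A' *v a)) \<in> L"
    using add_subgroupD(3)[OF L A'L[OF a]] by (simp add: matrix_vector_mult_scaleR vec.neg)
  have sub: "conjugate (aff a A) ` half_turn_group L \<subseteq> half_turn_group L"
    by (rule conjugate_half_turn_group_subset[OF L A AL a])
  have "conjugate (inv (aff a A)) ` half_turn_group L \<subseteq> half_turn_group L"
    unfolding inv_aff[OF A] by (rule conjugate_half_turn_group_subset[OF L A(2,1) A'L inv_a])
  then have "conjugate (aff a A) ` conjugate (inv (aff a A)) ` half_turn_group L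
      \<subseteq> conjugate (aff a A) ` half_turn_group L"
    by (rule image_mono)
  moreover have "bij (aff a A)"
    using A aff_in_affgroup affgroup_bij unfolding invertible_def by blast
  ultimately have "half_turn_group L \<subseteq> conjugate (aff a A) ` half_turn_group L"
    by (simp add: image_image)
  then show ?thesis
    using sub aff_in_affgroup A unfolding affnorm_iff invertible_def by blast
qed

lemma conjugate_linear_half_turn_group:
  assumes A: "A ** A' = mat 1" "A' ** A = mat 1"
  shows "conjugate (aff 0 A) ` half_turn_group L = half_turn_group ((*v) A ` L)"
  unfolding half_turn_group_def image_Un image_image
  using A by (simp add: conjugate_aff[OF A] matrix_vector_mult_0_right)

lemma orbit_half_turn_group: "orbit (half_turn_group L) x = (\<lambda>n. n + x) ` L \<union> (\<lambda>n. n - x) ` L"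
  unfolding orbit_def half_turn_group_def image_Un image_image by simp

definition min_norm_ge :: "pt set \<Rightarrow> real \<Rightarrow> bool" where
  "min_norm_ge L \<epsilon> \<longleftrightarrow> (\<forall>x\<in>L. x \<noteq> 0 \<longrightarrow> \<epsilon> \<le> norm x)"

lemma norm_le_norm_add_lattice:
  assumes "min_norm_ge L \<epsilon>" "k \<in> L" "norm w < \<epsilon> / 2"
  shows "norm w \<le> norm (k + w)"
proof (cases "k = 0")
  case False
  then have "\<epsilon> \<le> norm k" using assms unfolding min_norm_ge_def by blast
  then show ?thesis using norm_diff_ineq[of k w] assms(3) by linarith
qed simp

text \<open>Short displacements from a point of order two are not shortened by passing to the
  orbifold; this is what makes the linear part of a symmetry an isometry.\<close>

lemma orbdist_half_turn_group_short:
  assumes L: "add_subgroup L" and gap: "min_norm_ge L \<epsilon>" and c: "2 *\<^sub>R c \<in> L"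
    and w: "norm w < \<epsilon> / 2"
  shows "orbdist (orbit (half_turn_group L) c) (orbit (half_turn_group L) (c + w)) = norm w"
  unfolding orbdist_def orbit_half_turn_group
proof (rule cInf_eq_minimum)
  show "norm w \<in> {dist x y |x y. x \<in> (\<lambda>n. n + c) ` L \<union> (\<lambda>n. n - c) ` L
      \<and> y \<in> (\<lambda>n. n + (c + w)) ` L \<union> (\<lambda>n. n - (c + w)) ` L}"
    using add_subgroupD(1)[OF L] by (force simp: dist_norm)
  fix d assume "d \<in> {dist x y |x y. x \<in> (\<lambda>n. n + c) ` L \<union> (\<lambda>n. n - c) ` L
      \<and> y \<in> (\<lambda>n. n + (c + w)) ` L \<union> (\<lambda>n. n - (c + w)) ` L}"
  then obtain n m where n: "n \<in> L" and m: "m \<in> L"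
    and "d = norm ((n + c) - (m + (c + w))) \<or> d = norm ((n + c) - (m - (c + w)))
      \<or> d = norm ((n - c) - (m + (c + w))) \<or> d = norm ((n - c) - (m - (c + w)))"
    by (auto simp: dist_norm)
  then have "d = norm ((n - m) + - w) \<or> d = norm ((n - m + 2 *\<^sub>R c) + w)
      \<or> d = norm (- (n - m - 2 *\<^sub>R c) + w) \<or> d = norm ((n - m) + w)"
    by (auto simp: algebra_simps scaleR_2 simp flip: norm_minus_commute)
  moreover have "n - m \<in> L" "n - m + 2 *\<^sub>R c \<in> L" "- (n - m - 2 *\<^sub>R c) \<in> L"
    using n m c by (simp_all add: add_subgroupD[OF L])
  ultimately show "norm w \<le> d"
    using norm_le_norm_add_lattice[OF gap _ w] norm_le_norm_add_lattice[OF gap, of _ "- w"] w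
    by auto
qed

lemma Sym_half_turn_group_linear_part:
  assumes L: "add_subgroup L" and gap: "min_norm_ge L \<epsilon>" "0 < \<epsilon>"
    and \<phi>: "aff a A \<in> affnorm (half_turn_group L)"
    and sym: "star (half_turn_group L) (aff a A) \<in> Sym (half_turn_group L)"
  shows "norm (A *v v) = norm v"
proof -
  let ?\<Gamma> = "half_turn_group L"
  have \<Gamma>: "affine_subgroup ?\<Gamma>" using affine_subgroup_half_turn_group[OF L] .
  have a: "2 *\<^sub>R a \<in> L"
    using affnorm_half_turn_groupE[OF L \<phi>] aff_eq_iff by metis
  have short: "norm (A *v u) = norm u" if u: "norm u < \<epsilon> / 2" "norm (A *v u) < \<epsilon> / 2" for u
  proof -
    have "orbdist (star ?\<Gamma> (aff a A) (orbit ?\<Gamma> 0)) (star ?\<Gamma> (aff a A) (orbit ?\<Gamma> u))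
        = orbdist (orbit ?\<Gamma> 0) (orbit ?\<Gamma> u)"
      using sym unfolding Sym_def by simp
    then have "orbdist (orbit ?\<Gamma> a) (orbit ?\<Gamma> (a + A *v u)) = orbdist (orbit ?\<Gamma> 0) (orbit ?\<Gamma> (0 + u))"
      by (simp add: star_orbit[OF \<Gamma> \<phi>] matrix_vector_mult_0_right)
    moreover have "orbdist (orbit ?\<Gamma> 0) (orbit ?\<Gamma> (0 + u)) = norm u"
      using orbdist_half_turn_group_short[OF L gap(1) _ u(1), of 0] add_subgroupD(1)[OF L] by simp
    ultimately show ?thesis
      using orbdist_half_turn_group_short[OF L gap(1) a u(2)] by simp
  qed
  define N where "N = 1 + norm v + norm (A *v v)"
  define t where "t = \<epsilon> / (4 * N)"
  have N: "0 < N" unfolding N_def by (simp add: add_pos_nonneg)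
  then have t: "0 < t" "t * N = \<epsilon> / 4" using gap(2) by (simp_all add: t_def)
  have "t * norm v \<le> t * N" "t * norm (A *v v) \<le> t * N"
    using t(1) by (intro mult_left_mono; simp add: N_def)+
  then have short_t: "t * norm v < \<epsilon> / 2" "t * norm (A *v v) < \<epsilon> / 2"
    using t(2) gap(2) by linarith+
  have "t * norm (A *v v) = t * norm v"
    using short[of "t *\<^sub>R v"] t(1) short_t by (simp add: matrix_vector_mult_scaleR)
  then show ?thesis using t(1) by simp
qed

lemma Sym_half_turn_group:
  assumes L: "add_subgroup L" and gap: "min_norm_ge L \<epsilon>" "0 < \<epsilon>"
  shows "Sym (half_turn_group L)
    = star (half_turn_group L) ` {\<phi> \<in> affnorm (half_turn_group L). isometry \<phi>}"
proof
  let ?\<Gamma> = "half_turn_group L"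
  have \<Gamma>: "affine_subgroup ?\<Gamma>" using affine_subgroup_half_turn_group[OF L] .
  show "star ?\<Gamma> ` {\<phi> \<in> affnorm ?\<Gamma>. isometry \<phi>} \<subseteq> Sym ?\<Gamma>"
    unfolding Sym_def Aff_def using orbdist_star_isometry[OF \<Gamma>] by auto
  show "Sym ?\<Gamma> \<subseteq> star ?\<Gamma> ` {\<phi> \<in> affnorm ?\<Gamma>. isometry \<phi>}"
  proof
    fix f assume f: "f \<in> Sym ?\<Gamma>"
    then obtain \<phi> where \<phi>: "\<phi> \<in> affnorm ?\<Gamma>" "f = star ?\<Gamma> \<phi>"
      unfolding Sym_def Aff_def by blast
    then obtain a A where "\<phi> = aff a A" using affnorm_half_turn_groupE[OF L] by metis
    then have "isometry \<phi>"
      using Sym_half_turn_group_linear_part[OF L gap] \<phi> f by (simp add: isometry_aff_iff)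
    then show "f \<in> star ?\<Gamma> ` {\<phi> \<in> affnorm ?\<Gamma>. isometry \<phi>}" using \<phi> by blast
  qed
qed

lemma star_image_conjugate:
  assumes P: "P \<in> affgroup" and \<Gamma>: "affine_subgroup \<Gamma>"
  shows "star (conjugate P ` \<Gamma>) ` {\<phi> \<in> affnorm (conjugate P ` \<Gamma>). R \<phi>}
    = sharp P \<Gamma> (conjugate P ` \<Gamma>) ` star \<Gamma> ` {\<psi> \<in> affnorm \<Gamma>. R (conjugate P \<psi>)}"
proof -
  have "{\<phi> \<in> affnorm (conjugate P ` \<Gamma>). R \<phi>} = conjugate P ` {\<psi> \<in> affnorm \<Gamma>. R (conjugate P \<psi>)}"
    unfolding affnorm_conjugate_image[OF P] by blast
  then show ?thesis
    by (simp add: image_image sharp_star[OF P \<Gamma>])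
qed

section \<open>The square and the hexagonal lattice\<close>

lemma vec2_eq_iff: "x = y \<longleftrightarrow> x $ 1 = y $ 1 \<and> x $ 2 = y $ 2" for x y :: "'a^2"
  by (simp add: vec_eq_iff forall_2)

lemma matrix_vector_mult_component2: "(A *v x) $ i = A $ i $ 1 * x $ 1 + A $ i $ 2 * x $ 2"
  for A :: "real^2^2"
  by (simp add: matrix_vector_mult_def sum_2)

lemma norm_vec2_power2: "(norm x)\<^sup>2 = (x $ 1)\<^sup>2 + (x $ 2)\<^sup>2" for x :: "real^2"
  by (simp add: norm_vec_def L2_set_def sum_2)

lemma norm_eq_iff_vec2: "norm x = norm y \<longleftrightarrow> (x $ 1)\<^sup>2 + (x $ 2)\<^sup>2 = (y $ 1)\<^sup>2 + (y $ 2)\<^sup>2"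
  for x y :: "real^2"
  by (metis norm_vec2_power2 norm_ge_zero power2_eq_iff_nonneg)

lemma e1_e2_components [simp]: "e1 $ 1 = 1" "e1 $ 2 = 0" "e2 $ 1 = 0" "e2 $ 2 = 1"
  by (simp_all add: e1_def e2_def)

definition mat2 :: "real \<Rightarrow> real \<Rightarrow> real \<Rightarrow> real \<Rightarrow> real^2^2" where
  "mat2 a b c d = vector [vector [a, b], vector [c, d]]"

lemma mat2_components [simp]:
  "mat2 a b c d $ 1 $ 1 = a" "mat2 a b c d $ 1 $ 2 = b"
  "mat2 a b c d $ 2 $ 1 = c" "mat2 a b c d $ 2 $ 2 = d"
  by (simp_all add: mat2_def)

lemma mat2_eq_iff [simp]: "mat2 a b c d = mat2 a' b' c' d' \<longleftrightarrow> a = a' \<and> b = b' \<and> c = c' \<and> d = d'"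
  by (simp add: vec_eq_iff forall_2)

lemma mat2_entries: "M = mat2 (M $ 1 $ 1) (M $ 1 $ 2) (M $ 2 $ 1) (M $ 2 $ 2)"
  by (simp add: vec_eq_iff forall_2)

lemma uminus_mat2 [simp]: "- mat2 a b c d = mat2 (- a) (- b) (- c) (- d)"
  by (simp add: vec_eq_iff forall_2)

lemma mat2_mult [simp]:
  "mat2 a b c d ** mat2 a' b' c' d'
    = mat2 (a * a' + b * c') (a * b' + b * d') (c * a' + d * c') (c * b' + d * d')"
  by (simp add: vec_eq_iff forall_2 matrix_matrix_mult_def sum_2)

lemma mat_1_eq_mat2: "mat 1 = mat2 1 0 0 1"
  by (simp add: vec_eq_iff forall_2 mat_def)

lemma matA_eq: "matA = mat2 (-1) 0 0 1"
  and matB_eq: "matB = mat2 (-1) 1 0 1"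
  and matC_eq: "matC = mat2 0 1 1 0"
  and matD_eq: "matD = mat2 1 (-1/2) 0 (sqrt 3 / 2)"
  by (simp_all add: matA_def matB_def matC_def matD_def mat2_def)

definition integral_matrix :: "real^2^2 \<Rightarrow> bool" where
  "integral_matrix M \<longleftrightarrow> (\<forall>i j. M $ i $ j \<in> \<int>)"

abbreviation square_lattice :: "pt set" where
  "square_lattice \<equiv> int_lattice e1 e2"

definition hex_vector :: pt where
  "hex_vector = e1 /\<^sub>R 2 + (sqrt 3 / 2) *\<^sub>R e2"

abbreviation hex_lattice :: "pt set" where
  "hex_lattice \<equiv> int_lattice e1 hex_vector"

lemma hex_vector_components [simp]: "hex_vector $ 1 = 1 / 2" "hex_vector $ 2 = sqrt 3 / 2"
  by (simp_all add: hex_vector_def)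

lemma Mgrp_eq: "Mgrp = half_turn_group square_lattice"
  unfolding Mgrp_def by (rule gen_eq_half_turn_group)

lemma Deltagrp_eq: "Deltagrp = half_turn_group hex_lattice"
  unfolding Deltagrp_def hex_vector_def by (rule gen_eq_half_turn_group)

lemma mem_square_lattice_iff: "x \<in> square_lattice \<longleftrightarrow> x $ 1 \<in> \<int> \<and> x $ 2 \<in> \<int>"
proof
  assume "x \<in> square_lattice"
  then obtain i j where "x = of_int i *\<^sub>R e1 + of_int j *\<^sub>R e2"
    unfolding mem_int_lattice by blast
  then show "x $ 1 \<in> \<int> \<and> x $ 2 \<in> \<int>" by simp
next
  assume "x $ 1 \<in> \<int> \<and> x $ 2 \<in> \<int>"
  then obtain i j where "x $ 1 = of_int i" "x $ 2 = of_int j" by (auto elim!: Ints_cases)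
  then have "x = of_int i *\<^sub>R e1 + of_int j *\<^sub>R e2" by (simp add: vec2_eq_iff)
  then show "x \<in> square_lattice" unfolding mem_int_lattice by blast
qed

lemma min_norm_ge_square_lattice: "min_norm_ge square_lattice 1"
  unfolding min_norm_ge_def
proof (intro ballI impI)
  fix x assume x: "x \<in> square_lattice" "x \<noteq> 0"
  have "x $ 1 \<noteq> 0 \<or> x $ 2 \<noteq> 0" using x(2) by (simp add: vec2_eq_iff)
  then obtain i where i: "x $ i \<in> \<int>" "x $ i \<noteq> 0"
    using x(1) unfolding mem_square_lattice_iff by blast
  then have "1 \<le> \<bar>x $ i\<bar>" by (rule Ints_nonzero_abs_ge1)
  then show "1 \<le> norm x" using component_le_norm_cart[of x i] by linarith
qed

lemma int_quadratic_form_ge_1: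
  fixes i j :: int
  assumes "i \<noteq> 0 \<or> j \<noteq> 0"
  shows "1 \<le> i * i + i * j + j * j"
proof (cases "j = 0")
  case True
  then show ?thesis
    using assms by (auto simp: int_one_le_iff_zero_less zero_less_mult_iff linorder_neq_iff)
next
  case False
  then have "1 \<le> j * j" by (auto simp: int_one_le_iff_zero_less zero_less_mult_iff linorder_neq_iff)
  moreover have "4 * (i * i + i * j + j * j) = (2 * i + j) * (2 * i + j) + 3 * (j * j)"
    by (simp add: algebra_simps)
  moreover have "0 \<le> (2 * i + j) * (2 * i + j)" by simp
  moreover have "1 \<le> q" if "4 * q = s + 3 * t" "0 \<le> s" "1 \<le> t" for q s t :: int
    using that by linarith
  ultimately show ?thesis by blast
qed

lemma min_norm_ge_hex_lattice: "min_norm_ge hex_lattice 1"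
  unfolding min_norm_ge_def
proof (intro ballI impI)
  fix x assume x: "x \<in> hex_lattice" "x \<noteq> 0"
  then obtain i j where ij: "x = of_int i *\<^sub>R e1 + of_int j *\<^sub>R hex_vector"
    unfolding mem_int_lattice by blast
  then have "i \<noteq> 0 \<or> j \<noteq> 0" using x(2) by auto
  then have "(1::real) \<le> of_int (i * i + i * j + j * j)"
    unfolding of_int_1_le_iff by (rule int_quadratic_form_ge_1)
  moreover have "(norm x)\<^sup>2 = of_int (i * i + i * j + j * j)"
    unfolding norm_vec2_power2 ij by (simp add: power2_eq_square field_simps)
  ultimately have "1 \<le> (norm x)\<^sup>2" by (simp only:)
  then show "1 \<le> norm x" using power2_le_imp_le[of 1 "norm x"] by simp
qed

lemma integral_entry_cases:
  fixes x :: real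
  assumes "x \<in> \<int>" "x\<^sup>2 < 4"
  shows "x = -1 \<or> x = 0 \<or> x = 1"
proof -
  obtain i where i: "x = of_int i" using assms(1) by (auto elim: Ints_cases)
  have "\<bar>x\<bar> < 2" using power_less_imp_less_base[of "\<bar>x\<bar>" 2 2] assms(2) by simp
  then have "\<bar>i\<bar> < 2" unfolding i by (simp flip: of_int_abs)
  then have "i = -1 \<or> i = 0 \<or> i = 1" by arith
  then show ?thesis using i by auto
qed

lemma orthogonal_integral_matrix_cases:
  assumes "integral_matrix \<Psi>" and iso: "\<And>v. norm (\<Psi> *v v) = norm v"
  shows "\<exists>Xs \<in> {[], [matA], [matC], [matA, matC]}.
    \<Psi> = foldr (**) Xs (mat 1) \<or> \<Psi> = - foldr (**) Xs (mat 1)"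
proof -
  obtain a b c d where \<Psi>: "\<Psi> = mat2 a b c d" and ints: "a \<in> \<int>" "b \<in> \<int>" "c \<in> \<int>" "d \<in> \<int>"
    using assms(1) mat2_entries unfolding integral_matrix_def by metis
  have q: "a\<^sup>2 + c\<^sup>2 = 1" "b\<^sup>2 + d\<^sup>2 = 1" "(a + b)\<^sup>2 + (c + d)\<^sup>2 = 2"
    using iso[of e1] iso[of e2] iso[of "e1 + e2"] unfolding norm_eq_iff_vec2 \<Psi>
    by (simp_all add: matrix_vector_mult_component2)
  have "a\<^sup>2 < 4" "b\<^sup>2 < 4" "c\<^sup>2 < 4" "d\<^sup>2 < 4"
    using q(1,2) zero_le_power2[of a] zero_le_power2[of b] zero_le_power2[of c] zero_le_power2[of d]
    by linarith+
  then have "a = -1 \<or> a = 0 \<or> a = 1" "b = -1 \<or> b = 0 \<or> b = 1"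
    "c = -1 \<or> c = 0 \<or> c = 1" "d = -1 \<or> d = 0 \<or> d = 1"
    using ints integral_entry_cases by blast+
  then show ?thesis
    using q unfolding \<Psi> mat_1_eq_mat2 matA_eq matC_eq by (elim disjE) simp_all
qed

lemma norm_matD_power2: "(norm (matD *v x))\<^sup>2 = (x $ 1)\<^sup>2 - x $ 1 * x $ 2 + (x $ 2)\<^sup>2"
  unfolding norm_vec2_power2 matD_eq
  by (simp add: matrix_vector_mult_component2 power2_eq_square field_simps)

lemma hexagonal_form_bound:
  fixes x y :: real
  assumes "x\<^sup>2 - x * y + y\<^sup>2 = 1"
  shows "x\<^sup>2 < 4"
proof -
  have "4 * (x\<^sup>2 - x * y + y\<^sup>2) = 3 * x\<^sup>2 + (x - 2 * y)\<^sup>2"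
    by (simp add: power2_eq_square algebra_simps)
  then have "3 * x\<^sup>2 + (x - 2 * y)\<^sup>2 = 4" using assms by simp
  then show ?thesis using zero_le_power2[of "x - 2 * y"] by linarith
qed

lemma hexagonal_integral_matrix_cases:
  assumes "integral_matrix \<Psi>" and iso: "\<And>v. norm (matD *v (\<Psi> *v v)) = norm (matD *v v)"
  shows "\<exists>Xs \<in> {[], [matB], [matC], [matB, matC], [matC, matB], [matB, matC, matB]}.
    \<Psi> = foldr (**) Xs (mat 1) \<or> \<Psi> = - foldr (**) Xs (mat 1)"
proof -
  obtain a b c d where \<Psi>: "\<Psi> = mat2 a b c d" and ints: "a \<in> \<int>" "b \<in> \<int>" "c \<in> \<int>" "d \<in> \<int>"
    using assms(1) mat2_entries unfolding integral_matrix_def by metis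
  have iso2: "(norm (matD *v (\<Psi> *v v)))\<^sup>2 = (norm (matD *v v))\<^sup>2" for v using iso by simp
  have q: "a\<^sup>2 - a * c + c\<^sup>2 = 1" "b\<^sup>2 - b * d + d\<^sup>2 = 1"
    "(a + b)\<^sup>2 - (a + b) * (c + d) + (c + d)\<^sup>2 = 1"
    using iso2[of e1] iso2[of e2] iso2[of "e1 + e2"] unfolding norm_matD_power2 \<Psi>
    by (simp_all add: matrix_vector_mult_component2)
  have "c\<^sup>2 - c * a + a\<^sup>2 = 1" "d\<^sup>2 - d * b + b\<^sup>2 = 1" using q(1,2) by (simp_all add: algebra_simps)
  then have "a\<^sup>2 < 4" "b\<^sup>2 < 4" "c\<^sup>2 < 4" "d\<^sup>2 < 4"
    using q(1,2) hexagonal_form_bound by blast+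
  then have "a = -1 \<or> a = 0 \<or> a = 1" "b = -1 \<or> b = 0 \<or> b = 1"
    "c = -1 \<or> c = 0 \<or> c = 1" "d = -1 \<or> d = 0 \<or> d = 1"
    using ints integral_entry_cases by blast+
  then show ?thesis
    using q unfolding \<Psi> mat_1_eq_mat2 matB_eq matC_eq by (elim disjE) simp_all
qed

lemma matD_inverse: "matD ** mat2 1 (1 / sqrt 3) 0 (2 / sqrt 3) = mat 1"
  "mat2 1 (1 / sqrt 3) 0 (2 / sqrt 3) ** matD = mat 1"
  by (simp_all add: matD_eq mat_1_eq_mat2 field_simps)

lemma matD_square_lattice: "(*v) matD ` square_lattice = hex_lattice"
proof
  show "(*v) matD ` square_lattice \<subseteq> hex_lattice"
  proof
    fix y assume "y \<in> (*v) matD ` square_lattice"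
    then obtain x where "x \<in> square_lattice" "y = matD *v x" by blast
    then obtain i j where y: "y = matD *v (of_int i *\<^sub>R e1 + of_int j *\<^sub>R e2)"
      unfolding mem_int_lattice by blast
    have "y = of_int (i - j) *\<^sub>R e1 + of_int j *\<^sub>R hex_vector"
      unfolding y matD_eq by (simp add: vec2_eq_iff matrix_vector_mult_component2 field_simps)
    then show "y \<in> hex_lattice" unfolding mem_int_lattice by blast
  qed
  show "hex_lattice \<subseteq> (*v) matD ` square_lattice"
  proof
    fix y assume "y \<in> hex_lattice"
    then obtain i j where y: "y = of_int i *\<^sub>R e1 + of_int j *\<^sub>R hex_vector"
      unfolding mem_int_lattice by blast
    have "y = matD *v (of_int (i + j) *\<^sub>R e1 + of_int j *\<^sub>R e2)"
      unfolding y matD_eq by (simp add: vec2_eq_iff matrix_vector_mult_component2 field_simps)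
    moreover have "of_int (i + j) *\<^sub>R e1 + of_int j *\<^sub>R e2 \<in> square_lattice"
      unfolding mem_int_lattice by blast
    ultimately show "y \<in> (*v) matD ` square_lattice" by blast
  qed
qed

lemma aff_matD_affgroup: "aff 0 matD \<in> affgroup"
  using aff_in_affgroup matD_inverse unfolding invertible_def by blast

lemma conjugate_matD_Mgrp: "conjugate (aff 0 matD) ` Mgrp = Deltagrp"
  unfolding Mgrp_eq Deltagrp_eq conjugate_linear_half_turn_group[OF matD_inverse]
    matD_square_lattice ..

lemma integral_matrix_square_lattice:
  "integral_matrix A \<Longrightarrow> x \<in> square_lattice \<Longrightarrow> A *v x \<in> square_lattice"
  unfolding integral_matrix_def mem_square_lattice_iff
  by (simp add: matrix_vector_mult_component2)

lemma affnorm_MgrpE: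
  assumes "\<psi> \<in> affnorm Mgrp"
  obtains b \<Psi> where "\<psi> = aff b \<Psi>" "integral_matrix \<Psi>" "2 *\<^sub>R b \<in> square_lattice"
proof -
  obtain b \<Psi> where \<psi>: "\<psi> = aff b \<Psi>" "2 *\<^sub>R b \<in> square_lattice"
    and \<Psi>: "\<And>n. n \<in> square_lattice \<Longrightarrow> \<Psi> *v n \<in> square_lattice"
    using affnorm_half_turn_groupE[OF add_subgroup_int_lattice assms[unfolded Mgrp_eq]] by metis
  have "integral_matrix \<Psi>"
    using \<Psi>[OF int_lattice_generators(1)] \<Psi>[OF int_lattice_generators(2)]
    unfolding integral_matrix_def forall_2 mem_square_lattice_iff
    by (simp add: matrix_vector_mult_component2)
  then show ?thesis using that \<psi> by blast
qed

lemma aff_in_affnorm_Mgrp: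
  assumes "A ** A' = mat 1" "A' ** A = mat 1" "integral_matrix A" "integral_matrix A'"
    "2 *\<^sub>R b \<in> square_lattice"
  shows "aff b A \<in> affnorm Mgrp"
  unfolding Mgrp_eq using assms integral_matrix_square_lattice
  by (intro aff_in_affnorm_half_turn_group[OF add_subgroup_int_lattice]) auto

lemma isometry_conjugate_aff_iff:
  assumes Q: "Q ** Q' = mat 1" "Q' ** Q = mat 1"
  shows "isometry (conjugate (aff 0 Q) (aff b \<Psi>)) \<longleftrightarrow> (\<forall>v. norm (Q *v (\<Psi> *v v)) = norm (Q *v v))"
proof -
  have "(\<forall>u. norm ((Q ** \<Psi> ** Q') *v u) = norm u) \<longleftrightarrow> (\<forall>v. norm (Q *v (\<Psi> *v v)) = norm (Q *v v))"
  proof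
    show "\<forall>v. norm (Q *v (\<Psi> *v v)) = norm (Q *v v)" if "\<forall>u. norm ((Q ** \<Psi> ** Q') *v u) = norm u"
      using that[rule_format, of "Q *v _"] Q
      by (simp add: matrix_vector_mul_assoc flip: matrix_mul_assoc)
    show "\<forall>u. norm ((Q ** \<Psi> ** Q') *v u) = norm u" if "\<forall>v. norm (Q *v (\<Psi> *v v)) = norm (Q *v v)"
      using that[rule_format, of "Q' *v _"] Q
      by (simp add: matrix_vector_mul_assoc flip: matrix_mul_assoc)
  qed
  then show ?thesis by (simp add: conjugate_aff[OF Q] isometry_aff_iff)
qed

section \<open>Generators of the symmetry groups\<close>

lemma isometric_pullback_closed:
  fixes \<Gamma> :: "amap set"
  assumes P: "P \<in> affgroup"
  defines "H \<equiv> {\<psi> \<in> affnorm \<Gamma>. isometry (conjugate P \<psi>)}"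
  shows "id \<in> H" "\<phi> \<in> H \<Longrightarrow> \<psi> \<in> H \<Longrightarrow> \<phi> \<circ> \<psi> \<in> H" "\<phi> \<in> H \<Longrightarrow> inv \<phi> \<in> H"
proof -
  have bP: "bij P" using P affgroup_bij by blast
  show "id \<in> H" unfolding H_def using bP id_in_affnorm by (simp add: isometry_def)
  show "\<phi> \<circ> \<psi> \<in> H" if "\<phi> \<in> H" "\<psi> \<in> H"
    using that affnorm_comp isometry_comp unfolding H_def by (simp add: conjugate_comp[OF bP])
  show "inv \<phi> \<in> H" if "\<phi> \<in> H"
  proof -
    have \<phi>: "\<phi> \<in> affnorm \<Gamma>" "isometry (conjugate P \<phi>)" using that unfolding H_def by auto
    have "isometry (inv (conjugate P \<phi>))"
      using isometry_inv[OF bij_conjugate[OF bP affnorm_bij[OF \<phi>(1)]] \<phi>(2)] .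
    then show ?thesis
      using affnorm_inv[OF \<phi>(1)] conjugate_inv[OF bP affnorm_bij[OF \<phi>(1)]] unfolding H_def by simp
  qed
qed

lemma gen_on_subset_star_image:
  assumes \<Gamma>: "affine_subgroup \<Gamma>" and H: "H \<subseteq> affnorm \<Gamma>" "id \<in> H"
    "\<And>\<phi> \<psi>. \<phi> \<in> H \<Longrightarrow> \<psi> \<in> H \<Longrightarrow> \<phi> \<circ> \<psi> \<in> H" "\<And>\<phi>. \<phi> \<in> H \<Longrightarrow> inv \<phi> \<in> H"
    and S: "S \<subseteq> star \<Gamma> ` H"
  shows "gen_on (orbits \<Gamma>) S \<subseteq> star \<Gamma> ` H"
proof
  fix f assume "f \<in> gen_on (orbits \<Gamma>) S"
  then show "f \<in> star \<Gamma> ` H"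
  proof induction
    case gen_on_id
    show ?case unfolding star_id[OF \<Gamma>, symmetric] using H(2) by blast
  next
    case (gen_on_mult f s)
    then obtain \<phi> \<psi> where \<phi>: "\<phi> \<in> H" "f = star \<Gamma> \<phi>" and \<psi>: "\<psi> \<in> H" "s = star \<Gamma> \<psi>"
      using S by blast
    have "compose (orbits \<Gamma>) s f = star \<Gamma> (\<psi> \<circ> \<phi>)"
      unfolding \<phi>(2) \<psi>(2) using star_comp[OF \<Gamma>] \<phi>(1) \<psi>(1) H(1) by (simp add: subset_iff)
    then show ?case using H(3)[OF \<psi>(1) \<phi>(1)] by (metis image_eqI)
  next
    case (gen_on_inv f s)
    then obtain \<phi> \<psi> where \<phi>: "\<phi> \<in> H" "f = star \<Gamma> \<phi>" and \<psi>: "\<psi> \<in> H" "s = star \<Gamma> \<psi>"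
      using S by blast
    have \<psi>': "\<psi> \<in> affnorm \<Gamma>" and \<phi>': "\<phi> \<in> affnorm \<Gamma>" using \<phi>(1) \<psi>(1) H(1) by auto
    have "compose (orbits \<Gamma>) (restrict (inv_into (orbits \<Gamma>) s) (orbits \<Gamma>)) f = star \<Gamma> (inv \<psi> \<circ> \<phi>)"
      unfolding \<phi>(2) \<psi>(2) star_inv[OF \<Gamma> \<psi>'] star_comp[OF \<Gamma> affnorm_inv[OF \<psi>'] \<phi>'] ..
    then show ?case using H(3)[OF H(4)[OF \<psi>(1)] \<phi>(1)] by (metis image_eqI)
  qed
qed

primrec comp_list :: "('a \<Rightarrow> 'a) list \<Rightarrow> 'a \<Rightarrow> 'a" where
  "comp_list [] = id"
| "comp_list (f # fs) = f \<circ> comp_list fs"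

lemma comp_list_append: "comp_list (fs @ gs) = comp_list fs \<circ> comp_list gs"
  by (induction fs) (simp_all add: comp_assoc)

lemma comp_list_aff_linear: "comp_list (map (aff 0) Xs) = aff 0 (foldr (**) Xs (mat 1))"
  by (induction Xs) (simp_all del: aff_apply add: aff_comp matrix_vector_mult_0_right)

lemma star_comp_list_in_gen_on:
  assumes \<Gamma>: "affine_subgroup \<Gamma>" and gens: "\<And>\<phi>. \<phi> \<in> set \<phi>s \<Longrightarrow> \<phi> \<in> affnorm \<Gamma> \<and> star \<Gamma> \<phi> \<in> S"
  shows "comp_list \<phi>s \<in> affnorm \<Gamma> \<and> star \<Gamma> (comp_list \<phi>s) \<in> gen_on (orbits \<Gamma>) S"
  using gens
proof (induction \<phi>s)
  case Nil
  show ?case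
    unfolding comp_list.simps(1) star_id[OF \<Gamma>] using id_in_affnorm gen_on.gen_on_id by blast
next
  case (Cons \<phi> \<phi>s)
  then have \<phi>: "\<phi> \<in> affnorm \<Gamma>" "star \<Gamma> \<phi> \<in> S"
    and IH: "comp_list \<phi>s \<in> affnorm \<Gamma>" "star \<Gamma> (comp_list \<phi>s) \<in> gen_on (orbits \<Gamma>) S"
    by simp_all
  show ?case
    unfolding comp_list.simps(2) star_comp[OF \<Gamma> \<phi>(1) IH(1)]
    using affnorm_comp[OF \<phi>(1) IH(1)] gen_on.gen_on_mult[OF IH(2) \<phi>(2)] by blast
qed

lemma star_half_turn_group_reduce:
  assumes L: "add_subgroup L" and W: "aff a' W \<in> affnorm (half_turn_group L)"
    and b: "b - a' \<in> L" and \<Psi>: "\<Psi> = W \<or> \<Psi> = - W"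
  shows "star (half_turn_group L) (aff b \<Psi>) = star (half_turn_group L) (aff a' W)"
proof -
  have \<Gamma>: "affine_subgroup (half_turn_group L)" by (rule affine_subgroup_half_turn_group[OF L])
  have shift: "aff (b - a') (mat 1) \<in> half_turn_group L" and flip: "aff 0 (- mat 1) \<in> half_turn_group L"
    using b add_subgroupD(1)[OF L] by simp_all
  have "star (half_turn_group L) (aff b W) = star (half_turn_group L) (aff a' W)"
  proof -
    have "aff b W = aff (b - a') (mat 1) \<circ> aff a' W" by (simp del: aff_apply add: aff_comp)
    then show ?thesis using star_absorb_left[OF \<Gamma> shift W] by simp
  qed
  moreover have "star (half_turn_group L) (aff b (- W)) = star (half_turn_group L) (aff a' W)"
  proof -
    have "aff b (- W) = aff (b - a') (mat 1) \<circ> (aff a' W \<circ> aff 0 (- mat 1))"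
      by (simp del: aff_apply add: aff_comp matrix_vector_mult_0_right)
    moreover have "aff a' W \<circ> aff 0 (- mat 1) \<in> affnorm (half_turn_group L)"
      using affnorm_comp[OF W affine_subgroup_subset_affnorm[OF \<Gamma> flip]] .
    ultimately show ?thesis
      using star_absorb_left[OF \<Gamma> shift] star_absorb_right[OF \<Gamma> flip W] by simp
  qed
  ultimately show ?thesis using \<Psi> by blast
qed

lemma Ints_half_cases: "2 * x \<in> \<int> \<Longrightarrow> x \<in> \<int> \<or> x - 1 / 2 \<in> \<int>" for x :: real
proof -
  assume "2 * x \<in> \<int>"
  then obtain p where p: "2 * x = of_int p" by (auto elim: Ints_cases)
  show ?thesis
  proof (cases "even p")
    case True
    then obtain k where "p = 2 * k" by blast
    then have "x = of_int k" using p by simp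
    then show ?thesis by simp
  next
    case False
    then obtain k where "p = 2 * k + 1" by (blast elim: oddE)
    then have "x - 1 / 2 = of_int k" using p by simp
    then show ?thesis by (metis Ints_of_int)
  qed
qed

lemma half_square_lattice_reduce:
  assumes "2 *\<^sub>R b \<in> square_lattice"
  obtains ts a' where "set ts \<subseteq> {aff (e1 /\<^sub>R 2) (mat 1), aff (e2 /\<^sub>R 2) (mat 1)}"
    "comp_list ts = aff a' (mat 1)" "b - a' \<in> square_lattice"
proof -
  have "b $ 1 \<in> \<int> \<or> b $ 1 - 1 / 2 \<in> \<int>" "b $ 2 \<in> \<int> \<or> b $ 2 - 1 / 2 \<in> \<int>"
    using assms Ints_half_cases unfolding mem_square_lattice_iff by auto
  then show ?thesis
  proof (elim disjE)
    assume "b $ 1 \<in> \<int>" "b $ 2 \<in> \<int>"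
    then show ?thesis using that[of "[]" 0] by (simp add: mem_square_lattice_iff)
  next
    assume "b $ 1 - 1 / 2 \<in> \<int>" "b $ 2 \<in> \<int>"
    then show ?thesis
      using that[of "[aff (e1 /\<^sub>R 2) (mat 1)]" "e1 /\<^sub>R 2"] by (simp add: mem_square_lattice_iff)
  next
    assume "b $ 1 \<in> \<int>" "b $ 2 - 1 / 2 \<in> \<int>"
    then show ?thesis
      using that[of "[aff (e2 /\<^sub>R 2) (mat 1)]" "e2 /\<^sub>R 2"] by (simp add: mem_square_lattice_iff)
  next
    assume "b $ 1 - 1 / 2 \<in> \<int>" "b $ 2 - 1 / 2 \<in> \<int>"
    then show ?thesis
      using that[of "[aff (e1 /\<^sub>R 2) (mat 1), aff (e2 /\<^sub>R 2) (mat 1)]" "e1 /\<^sub>R 2 + e2 /\<^sub>R 2"]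
      by (simp add: mem_square_lattice_iff aff_comp)
  qed
qed

lemma half_translations_affnorm_Mgrp:
  "aff (e1 /\<^sub>R 2) (mat 1) \<in> affnorm Mgrp" "aff (e2 /\<^sub>R 2) (mat 1) \<in> affnorm Mgrp"
proof -
  have "integral_matrix (mat 1)" by (simp add: integral_matrix_def mat_def)
  then show "aff (e1 /\<^sub>R 2) (mat 1) \<in> affnorm Mgrp" "aff (e2 /\<^sub>R 2) (mat 1) \<in> affnorm Mgrp"
    by (auto intro!: aff_in_affnorm_Mgrp[of "mat 1" "mat 1"] simp: int_lattice_generators)
qed

lemma gen_on_mem:
  assumes "s \<in> S" "s \<in> extensional \<Omega>"
  shows "s \<in> gen_on \<Omega> S"
proof -
  have "compose \<Omega> s (\<lambda>x \<in> \<Omega>. x) = s"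
    using assms(2) by (auto simp: compose_def extensional_def)
  then show ?thesis using gen_on.gen_on_mult[OF gen_on.gen_on_id[of \<Omega> S] assms(1)] by simp
qed

lemma half_translations_Kgrp:
  "star Mgrp (aff (e1 /\<^sub>R 2) (mat 1)) \<in> Kgrp" "star Mgrp (aff (e2 /\<^sub>R 2) (mat 1)) \<in> Kgrp"
  unfolding Kgrp_def by (rule gen_on_mem; simp add: star_def)+

text \<open>An isometry of the orbifold, pulled back to \<open>M\<close>-coordinates by \<open>x \<mapsto> Q x\<close>, has the
  form \<open>x \<mapsto> b \<plusminus> W x\<close> with \<open>2b\<close> integral and \<open>W\<close> a word in \<open>Gs\<close>; modulo \<open>M\<close> it is a word
  in the half-translations and \<open>Gs\<close>.\<close>

lemma gen_on_Kgrp_eq_star_isometries: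
  assumes Q: "Q ** Q' = mat 1" "Q' ** Q = mat 1"
    and Gs: "\<And>X. X \<in> Gs \<Longrightarrow> aff 0 X \<in> affnorm Mgrp \<and> (\<forall>v. norm (Q *v (X *v v)) = norm (Q *v v))"
    and words: "\<And>\<Psi>. integral_matrix \<Psi> \<Longrightarrow> \<forall>v. norm (Q *v (\<Psi> *v v)) = norm (Q *v v) \<Longrightarrow>
      \<exists>Xs. set Xs \<subseteq> Gs \<and> (\<Psi> = foldr (**) Xs (mat 1) \<or> \<Psi> = - foldr (**) Xs (mat 1))"
  shows "gen_on (orbits Mgrp) (Kgrp \<union> (\<lambda>X. star Mgrp (aff 0 X)) ` Gs)
    = star Mgrp ` {\<psi> \<in> affnorm Mgrp. isometry (conjugate (aff 0 Q) \<psi>)}"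
    (is "gen_on _ ?S = star Mgrp ` ?H")
proof
  have M: "affine_subgroup Mgrp"
    unfolding Mgrp_eq by (rule affine_subgroup_half_turn_group[OF add_subgroup_int_lattice])
  have P: "aff 0 Q \<in> affgroup" using aff_in_affgroup Q unfolding invertible_def by blast
  have H_sub: "?H \<subseteq> affnorm Mgrp" by blast
  note H_closed = isometric_pullback_closed[OF P]
  note in_H = isometry_conjugate_aff_iff[OF Q]
  have "Kgrp \<subseteq> star Mgrp ` ?H"
  proof -
    have "aff (e1 /\<^sub>R 2) (mat 1) \<in> ?H" "aff (e2 /\<^sub>R 2) (mat 1) \<in> ?H"
      using half_translations_affnorm_Mgrp by (simp_all add: in_H)
    then show ?thesis
      unfolding Kgrp_def by (intro gen_on_subset_star_image[OF M H_sub H_closed]) auto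
  qed
  moreover have "(\<lambda>X. star Mgrp (aff 0 X)) ` Gs \<subseteq> star Mgrp ` ?H"
  proof (rule image_subsetI)
    fix X assume "X \<in> Gs"
    then have "aff 0 X \<in> ?H" using Gs by (simp add: in_H)
    then show "star Mgrp (aff 0 X) \<in> star Mgrp ` ?H" by (rule imageI)
  qed
  ultimately show "gen_on (orbits Mgrp) ?S \<subseteq> star Mgrp ` ?H"
    by (intro gen_on_subset_star_image[OF M H_sub H_closed] Un_least)
  show "star Mgrp ` ?H \<subseteq> gen_on (orbits Mgrp) ?S"
  proof
    fix f assume "f \<in> star Mgrp ` ?H"
    then obtain \<psi> where \<psi>: "\<psi> \<in> ?H" "f = star Mgrp \<psi>" by blast
    then obtain b \<Psi> where b\<Psi>: "\<psi> = aff b \<Psi>" "integral_matrix \<Psi>" "2 *\<^sub>R b \<in> square_lattice"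
      using affnorm_MgrpE by blast
    have "\<forall>v. norm (Q *v (\<Psi> *v v)) = norm (Q *v v)" using \<psi>(1) b\<Psi>(1) by (simp add: in_H)
    then obtain Xs where Xs: "set Xs \<subseteq> Gs" "\<Psi> = foldr (**) Xs (mat 1) \<or> \<Psi> = - foldr (**) Xs (mat 1)"
      using words[OF b\<Psi>(2)] by blast
    obtain ts a' where ts: "set ts \<subseteq> {aff (e1 /\<^sub>R 2) (mat 1), aff (e2 /\<^sub>R 2) (mat 1)}"
      "comp_list ts = aff a' (mat 1)" "b - a' \<in> square_lattice"
      using half_square_lattice_reduce[OF b\<Psi>(3)] by blast
    have word: "comp_list (ts @ map (aff 0) Xs) = aff a' (foldr (**) Xs (mat 1))"
      by (simp del: aff_apply add: comp_list_append ts(2) comp_list_aff_linear aff_comp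
          matrix_vector_mult_0_right)
    have gens: "\<phi> \<in> affnorm Mgrp \<and> star Mgrp \<phi> \<in> ?S" if \<phi>: "\<phi> \<in> set (ts @ map (aff 0) Xs)" for \<phi>
    proof -
      consider "\<phi> \<in> set ts" | X where "X \<in> Gs" "\<phi> = aff 0 X" using \<phi> Xs(1) by auto
      then show ?thesis
      proof cases
        case 1
        then have "\<phi> = aff (e1 /\<^sub>R 2) (mat 1) \<or> \<phi> = aff (e2 /\<^sub>R 2) (mat 1)" using ts(1) by auto
        then show ?thesis using half_translations_affnorm_Mgrp half_translations_Kgrp by auto
      next
        case 2
        then show ?thesis using Gs[OF 2(1)] by auto
      qed
    qed
    have "aff a' (foldr (**) Xs (mat 1)) \<in> affnorm Mgrp \<and>
      star Mgrp (aff a' (foldr (**) Xs (mat 1))) \<in> gen_on (orbits Mgrp) ?S"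
      unfolding word[symmetric] using gens by (rule star_comp_list_in_gen_on[OF M])
    moreover have "f = star Mgrp (aff a' (foldr (**) Xs (mat 1)))"
      using star_half_turn_group_reduce[OF add_subgroup_int_lattice _ ts(3) Xs(2)] calculation
        \<psi>(2) b\<Psi>(1)
      unfolding Mgrp_eq by simp
    ultimately show "f \<in> gen_on (orbits Mgrp) ?S" by simp
  qed
qed

lemma affine_subgroup_Mgrp: "affine_subgroup Mgrp"
  unfolding Mgrp_eq by (rule affine_subgroup_half_turn_group[OF add_subgroup_int_lattice])

lemma reflections_affnorm_Mgrp:
  "aff 0 matA \<in> affnorm Mgrp" "aff 0 matB \<in> affnorm Mgrp" "aff 0 matC \<in> affnorm Mgrp"
  by (rule aff_in_affnorm_Mgrp[of matA matA] aff_in_affnorm_Mgrp[of matB matB]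
      aff_in_affnorm_Mgrp[of matC matC];
      simp add: matA_eq matB_eq matC_eq mat_1_eq_mat2 integral_matrix_def forall_2
        add_subgroupD(1)[OF add_subgroup_int_lattice])+

lemma norm_matA_matC: "norm (matA *v v) = norm v" "norm (matC *v v) = norm v"
  by (simp_all add: norm_eq_iff_vec2 matA_eq matC_eq matrix_vector_mult_component2 algebra_simps)

lemma norm_matD_matB_matC:
  "norm (matD *v (matB *v v)) = norm (matD *v v)" "norm (matD *v (matC *v v)) = norm (matD *v v)"
proof -
  have "(norm (matD *v (matB *v v)))\<^sup>2 = (norm (matD *v v))\<^sup>2"
    "(norm (matD *v (matC *v v)))\<^sup>2 = (norm (matD *v v))\<^sup>2"
    unfolding norm_matD_power2
    by (simp_all add: matB_eq matC_eq matrix_vector_mult_component2 power2_eq_square algebra_simps)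
  then show "norm (matD *v (matB *v v)) = norm (matD *v v)" "norm (matD *v (matC *v v)) = norm (matD *v v)"
    by (simp_all add: power2_eq_iff_nonneg)
qed

lemma Sym_Mgrp:
  "Sym Mgrp = gen_on (orbits Mgrp) (Kgrp \<union> {star Mgrp (aff 0 matA), star Mgrp (aff 0 matC)})"
proof -
  have "Sym Mgrp = star Mgrp ` {\<psi> \<in> affnorm Mgrp. isometry (conjugate (aff 0 (mat 1)) \<psi>)}"
    unfolding Mgrp_eq
    using Sym_half_turn_group[OF add_subgroup_int_lattice min_norm_ge_square_lattice] by simp
  also have "\<dots> = gen_on (orbits Mgrp) (Kgrp \<union> (\<lambda>X. star Mgrp (aff 0 X)) ` {matA, matC})"
  proof (rule gen_on_Kgrp_eq_star_isometries[symmetric])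
    show "\<exists>Xs. set Xs \<subseteq> {matA, matC} \<and> (\<Psi> = foldr (**) Xs (mat 1) \<or> \<Psi> = - foldr (**) Xs (mat 1))"
      if \<Psi>: "integral_matrix \<Psi>" and iso: "\<forall>v. norm (mat 1 *v (\<Psi> *v v)) = norm (mat 1 *v v)" for \<Psi>
    proof -
      have "norm (\<Psi> *v v) = norm v" for v using iso by simp
      then obtain Xs where "Xs \<in> {[], [matA], [matC], [matA, matC]}"
        "\<Psi> = foldr (**) Xs (mat 1) \<or> \<Psi> = - foldr (**) Xs (mat 1)"
        using orthogonal_integral_matrix_cases[OF \<Psi>] by blast
      then show ?thesis by (intro exI[of _ Xs]) auto
    qed
  qed (use reflections_affnorm_Mgrp norm_matA_matC in auto)
  finally show ?thesis by simp
qed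

lemma Sym_Deltagrp:
  "Sym Deltagrp = sharp (aff 0 matD) Mgrp Deltagrp `
     gen_on (orbits Mgrp) (Kgrp \<union> {star Mgrp (aff 0 matB), star Mgrp (aff 0 matC)})"
proof -
  have "Sym Deltagrp = star Deltagrp ` {\<phi> \<in> affnorm Deltagrp. isometry \<phi>}"
    unfolding Deltagrp_eq
    using Sym_half_turn_group[OF add_subgroup_int_lattice min_norm_ge_hex_lattice] by simp
  also have "\<dots> = sharp (aff 0 matD) Mgrp Deltagrp `
      star Mgrp ` {\<psi> \<in> affnorm Mgrp. isometry (conjugate (aff 0 matD) \<psi>)}"
    using star_image_conjugate[OF aff_matD_affgroup affine_subgroup_Mgrp] unfolding conjugate_matD_Mgrp .
  also have "star Mgrp ` {\<psi> \<in> affnorm Mgrp. isometry (conjugate (aff 0 matD) \<psi>)}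
      = gen_on (orbits Mgrp) (Kgrp \<union> (\<lambda>X. star Mgrp (aff 0 X)) ` {matB, matC})"
  proof (rule gen_on_Kgrp_eq_star_isometries[OF matD_inverse, symmetric])
    show "\<exists>Xs. set Xs \<subseteq> {matB, matC} \<and> (\<Psi> = foldr (**) Xs (mat 1) \<or> \<Psi> = - foldr (**) Xs (mat 1))"
      if \<Psi>: "integral_matrix \<Psi>" and iso: "\<forall>v. norm (matD *v (\<Psi> *v v)) = norm (matD *v v)" for \<Psi>
    proof -
      obtain Xs where "Xs \<in> {[], [matB], [matC], [matB, matC], [matC, matB], [matB, matC, matB]}"
        "\<Psi> = foldr (**) Xs (mat 1) \<or> \<Psi> = - foldr (**) Xs (mat 1)"
        using hexagonal_integral_matrix_cases[OF \<Psi>] iso by blast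
      then show ?thesis by (intro exI[of _ Xs]) auto
    qed
  qed (use reflections_affnorm_Mgrp norm_matD_matB_matC in auto)
  finally show ?thesis by (simp del: aff_apply)
qed

theorem lemma24:
  shows "Sym Mgrp = gen_on (orbits Mgrp) (Kgrp \<union> {star Mgrp (aff 0 matA), star Mgrp (aff 0 matC)})
    \<and> (\<lambda>g. aff 0 matD \<circ> g \<circ> inv (aff 0 matD)) ` Mgrp = Deltagrp
    \<and> bij_betw (sharp (aff 0 matD) Mgrp Deltagrp) (Aff Mgrp) (Aff Deltagrp)
    \<and> (\<forall>f \<in> Aff Mgrp. \<forall>g \<in> Aff Mgrp.
           sharp (aff 0 matD) Mgrp Deltagrp (compose (orbits Mgrp) f g)
           = compose (orbits Deltagrp) (sharp (aff 0 matD) Mgrp Deltagrp f) (sharp (aff 0 matD) Mgrp Deltagrp g))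
    \<and> Sym Deltagrp = sharp (aff 0 matD) Mgrp Deltagrp ` gen_on (orbits Mgrp) (Kgrp \<union> {star Mgrp (aff 0 matB), star Mgrp (aff 0 matC)})"
proof (intro conjI ballI)
  show "Sym Mgrp = gen_on (orbits Mgrp) (Kgrp \<union> {star Mgrp (aff 0 matA), star Mgrp (aff 0 matC)})"
    by (rule Sym_Mgrp)
  show "(\<lambda>g. aff 0 matD \<circ> g \<circ> inv (aff 0 matD)) ` Mgrp = Deltagrp"
    using conjugate_matD_Mgrp unfolding conjugate_def .
  show "bij_betw (sharp (aff 0 matD) Mgrp Deltagrp) (Aff Mgrp) (Aff Deltagrp)"
    using bij_betw_sharp[OF aff_matD_affgroup affine_subgroup_Mgrp] unfolding conjugate_matD_Mgrp .
  show "sharp (aff 0 matD) Mgrp Deltagrp (compose (orbits Mgrp) f g)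
      = compose (orbits Deltagrp) (sharp (aff 0 matD) Mgrp Deltagrp f) (sharp (aff 0 matD) Mgrp Deltagrp g)"
    if "f \<in> Aff Mgrp" "g \<in> Aff Mgrp" for f g
    using sharp_compose[OF aff_matD_affgroup affine_subgroup_Mgrp that] unfolding conjugate_matD_Mgrp .
  show "Sym Deltagrp = sharp (aff 0 matD) Mgrp Deltagrp `
      gen_on (orbits Mgrp) (Kgrp \<union> {star Mgrp (aff 0 matB), star Mgrp (aff 0 matC)})"
    by (rule Sym_Deltagrp)
qed
end
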